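(* For $q=1,\dots,N$ define vectors $\theta^{\{q\}}(\mathfrak t)\in\mathbb R^{s^{\{q\}}}$ for $\mathfrak t\in\mathbb T_N$ recursively by: $\theta^{\{q\}}(\emptyset)=0$; $\theta^{\{q\}}(\tau_{\bigcirc q})=\mathbf 1^{\{q\}}$; $\theta^{\{q\}}([\mathfrak t_1]_{\bigcirc q})=\sum_{m=1}^N\beta^{\{q,m\}}\theta^{\{m\}}(\mathfrak t_1)$; $\theta^{\{q\}}([\mathfrak t_1,\dots,\mathfrak t_L]_{\bigcirc q})=\times_{\ell=1}^L\big(\sum_{m=1}^N\alpha^{\{q,m\}}\theta^{\{m\}}(\mathfrak t_\ell)\big)$ for $L\ge2$; and $\theta^{\{q\}}(\mathfrak t)=0$ whenever the root of $\mathfrak t$ does not have color $q$. Then the GARK-ROS method has order of consistency $p$ (for all smooth $\mathbf f^{\{1\}},\dots,\mathbf f^{\{N\}}$) if and only if $$\sum_{m=1}^N b^{\{m\}T}\theta^{\{m\}}(\mathfrak t)=\frac{1}{\gamma(\mathfrak t)}\quad\text{for all }\mathfrak t\in\mathbb T_N\text{ with }1\le\rho(\mathfrak t)\le p.$$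
   Context: Problem: $\mathbf y'=\sum_{m=1}^N\mathbf f^{\{m\}}(\mathbf y)$, $\mathbf y\in\mathbb R^d$, smooth $\mathbf f^{\{m\}}$. GARK-ROS method: for each $q$ a number of stages $s^{\{q\}}$, weights $b^{\{q\}}\in\mathbb R^{s^{\{q\}}}$, and coefficient matrices $\alpha^{\{q,m\}},\gamma^{\{q,m\}}\in\mathbb R^{s^{\{q\}}\times s^{\{m\}}}$ with $\alpha^{\{q,m\}}_{i,j}=0$ for $j\ge i$ and $\gamma^{\{q,m\}}_{i,j}=0$ for $j>i$; $\beta^{\{q,m\}}=\alpha^{\{q,m\}}+\gamma^{\{q,m\}}$. One step: $k_i^{\{q\}}=h\,\mathbf f^{\{q\}}\big(\mathbf y_n+\sum_{m=1}^N\sum_{j=1}^{i-1}\alpha^{\{q,m\}}_{i,j}k_j^{\{m\}}\big)+h\,\mathbf J_n^{\{q\}}\sum_{m=1}^N\sum_{j=1}^{i}\gamma^{\{q,m\}}_{i,j}k_j^{\{m\}}$, $i=1,\dots,s^{\{q\}}$, $q=1,\dots,N$, and $\mathbf y_{n+1}=\mathbf y_n+\sum_{q}\sum_i b^{\{q\}}_ik_i^{\{q\}}$, where $\mathbf J_n^{\{q\}}=\partial\mathbf f^{\{q\}}/\partial\mathbf y(\mathbf y_n)$. Order $p$ means the local error $\mathbf y_{n+1}-\mathbf y(t_n+h)$ with $\mathbf y(t_n)=\mathbf y_n$ is $O(h^{p+1})$. $\mathbf 1^{\{q\}}\in\mathbb R^{s^{\{q\}}}$ is the vector of ones; $\times$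 denotes componentwise product of vectors. Trees: $\mathbb T_N$ is the set of rooted trees (including the empty tree $\emptyset$) whose vertices are colored with colors $1,\dots,N$; $\tau_{\bigcirc m}$ is the single vertex of color $m$; $[\mathfrak t_1,\dots,\mathfrak t_L]_{\bigcirc m}$ attaches nonempty trees $\mathfrak t_1,\dots,\mathfrak t_L$ as children of a new root of color $m$. $\rho(\mathfrak t)$ is the number of vertices; the density $\gamma(\mathfrak t)$ (not to be confused with the matrices $\gamma^{\{q,m\}}$) is defined by $\gamma(\emptyset)=\gamma(\tau_{\bigcirc m})=1$, $\gamma([\mathfrak t_1,\dots,\mathfrak t_L]_{\bigcirc m})=\rho(\mathfrak t)\gamma(\mathfrak t_1)\cdots\gamma(\mathfrak t_L)$. *)

theory Defs
  imports "HOL-Analysis.Analysis"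
begin

text \<open>A vector of R^d is represented by its coordinates as a function nat => real;
  only the coordinates 0..d-1 matter.  A map f : R^d -> R^d is a function
  (nat => real) => (nat => real) that depends only on the first d input
  coordinates and whose output coordinates >= d vanish.\<close>

definition coord_dep :: "nat \<Rightarrow> ((nat \<Rightarrow> real) \<Rightarrow> real) \<Rightarrow> bool" where
  "coord_dep d g \<longleftrightarrow> (\<forall>x x'. (\<forall>c<d. x c = x' c) \<longrightarrow> g x = g x')"

definition coord_cont :: "nat \<Rightarrow> ((nat \<Rightarrow> real) \<Rightarrow> real) \<Rightarrow> bool" where
  "coord_cont d g \<longleftrightarrow> (\<forall>x. \<forall>e>0. \<exists>del>0. \<forall>x'.
      (\<forall>c<d. \<bar>x' c - x c\<bar> < del) \<longrightarrow> \<bar>g x' - g x\<bar> < e)"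

fun pd :: "((nat \<Rightarrow> real) \<Rightarrow> real) \<Rightarrow> nat list \<Rightarrow> (nat \<Rightarrow> real) \<Rightarrow> real" where
  "pd g [] = g"
| "pd g (j # js) = (\<lambda>x. deriv (\<lambda>t. pd g js (x(j := t))) (x j))"

definition smooth_fun :: "nat \<Rightarrow> ((nat \<Rightarrow> real) \<Rightarrow> real) \<Rightarrow> bool" where
  "smooth_fun d g \<longleftrightarrow> coord_dep d g \<and>
     (\<forall>js. set js \<subseteq> {..<d} \<longrightarrow> coord_cont d (pd g js) \<and>
        (\<forall>j<d. \<forall>x. (\<lambda>t. pd g js (x(j := t))) differentiable (at (x j))))"

definition smooth_field :: "nat \<Rightarrow> ((nat \<Rightarrow> real) \<Rightarrow> (nat \<Rightarrow> real)) \<Rightarrow> bool" where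
  "smooth_field d F \<longleftrightarrow> (\<forall>x c. d \<le> c \<longrightarrow> F x c = 0) \<and> (\<forall>c<d. smooth_fun d (\<lambda>x. F x c))"

definition jac :: "nat \<Rightarrow> ((nat \<Rightarrow> real) \<Rightarrow> (nat \<Rightarrow> real)) \<Rightarrow> (nat \<Rightarrow> real) \<Rightarrow> (nat \<Rightarrow> real) \<Rightarrow> (nat \<Rightarrow> real)" where
  "jac d F x v = (\<lambda>c. \<Sum>j<d. deriv (\<lambda>t. F (x(j := t)) c) (x j) * v j)"

text \<open>Partitions q = 1..N, stages i = 1..s q.  Coefficients
  al q m i j = alpha^{q,m}_{i,j}, ga q m i j = gamma^{q,m}_{i,j}, b q i = b^{q}_i.
  Stage vectors k q i :: nat => real.\<close>

definition stage_eqs ::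
  "nat \<Rightarrow> (nat \<Rightarrow> nat) \<Rightarrow> (nat \<Rightarrow> nat \<Rightarrow> nat \<Rightarrow> nat \<Rightarrow> real) \<Rightarrow> (nat \<Rightarrow> nat \<Rightarrow> nat \<Rightarrow> nat \<Rightarrow> real)
   \<Rightarrow> nat \<Rightarrow> (nat \<Rightarrow> (nat \<Rightarrow> real) \<Rightarrow> (nat \<Rightarrow> real)) \<Rightarrow> (nat \<Rightarrow> real) \<Rightarrow> real
   \<Rightarrow> (nat \<Rightarrow> nat \<Rightarrow> nat \<Rightarrow> real) \<Rightarrow> bool" where
  "stage_eqs N s al ga d f y0 h k \<longleftrightarrow>
     (\<forall>q\<in>{1..N}. \<forall>i\<in>{1..s q}.
        k q i = (\<lambda>c.
          h * f q (\<lambda>c'. y0 c' + (\<Sum>m\<in>{1..N}. \<Sum>j\<in>{1..s m}. al q m i j * k m j c')) c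
        + h * jac d (f q) y0 (\<lambda>c'. \<Sum>m\<in>{1..N}. \<Sum>j\<in>{1..s m}. ga q m i j * k m j c') c))"

definition step_result ::
  "nat \<Rightarrow> (nat \<Rightarrow> nat) \<Rightarrow> (nat \<Rightarrow> nat \<Rightarrow> real) \<Rightarrow> (nat \<Rightarrow> real) \<Rightarrow> (nat \<Rightarrow> nat \<Rightarrow> nat \<Rightarrow> real)
   \<Rightarrow> (nat \<Rightarrow> real)" where
  "step_result N s b y0 k = (\<lambda>c. y0 c + (\<Sum>q\<in>{1..N}. \<Sum>i\<in>{1..s q}. b q i * k q i c))"

definition is_solution ::
  "nat \<Rightarrow> nat \<Rightarrow> (nat \<Rightarrow> (nat \<Rightarrow> real) \<Rightarrow> (nat \<Rightarrow> real)) \<Rightarrow> (nat \<Rightarrow> real) \<Rightarrow> real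
   \<Rightarrow> (real \<Rightarrow> nat \<Rightarrow> real) \<Rightarrow> bool" where
  "is_solution N d f y0 T y \<longleftrightarrow> y 0 = y0 \<and>
     (\<forall>c<d. \<forall>t\<in>{0..T}.
        ((\<lambda>t. y t c) has_real_derivative (\<Sum>m\<in>{1..N}. f m (y t) c)) (at t within {0..T}))"

definition gark_ros_order ::
  "nat \<Rightarrow> (nat \<Rightarrow> nat) \<Rightarrow> (nat \<Rightarrow> nat \<Rightarrow> real) \<Rightarrow> (nat \<Rightarrow> nat \<Rightarrow> nat \<Rightarrow> nat \<Rightarrow> real)
   \<Rightarrow> (nat \<Rightarrow> nat \<Rightarrow> nat \<Rightarrow> nat \<Rightarrow> real) \<Rightarrow> nat \<Rightarrow> bool" where
  "gark_ros_order N s b al ga p \<longleftrightarrow>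
     (\<forall>d f. (\<forall>m\<in>{1..N}. smooth_field d (f m)) \<longrightarrow>
       (\<forall>y0 T y. T > 0 \<longrightarrow> is_solution N d f y0 T y \<longrightarrow>
         (\<exists>C del. del > 0 \<and> (\<forall>h k. 0 < h \<and> h < del \<longrightarrow> stage_eqs N s al ga d f y0 h k \<longrightarrow>
            (\<forall>c<d. \<bar>step_result N s b y0 k c - y h c\<bar> \<le> C * h ^ (p + 1))))))"

text \<open>Node c ts: root of colour c with children ts (ts = [] gives tau_c).
  The empty tree is not needed since only trees with rho >= 1 are used.\<close>
datatype ctree = Node nat "ctree list"

fun colors_ok :: "nat \<Rightarrow> ctree \<Rightarrow> bool" where
  "colors_ok N (Node c ts) = (c \<in> {1..N} \<and> (\<forall>t\<in>set ts. colors_ok N t))"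

fun rho :: "ctree \<Rightarrow> nat" where
  "rho (Node c ts) = 1 + sum_list (map rho ts)"

fun dens :: "ctree \<Rightarrow> nat" where
  "dens (Node c ts) = rho (Node c ts) * prod_list (map dens ts)"

text \<open>theta N s al ga q t i is the i-th entry of theta^{q}(t); beta = alpha + gamma.\<close>
fun theta :: "nat \<Rightarrow> (nat \<Rightarrow> nat) \<Rightarrow> (nat \<Rightarrow> nat \<Rightarrow> nat \<Rightarrow> nat \<Rightarrow> real) \<Rightarrow> (nat \<Rightarrow> nat \<Rightarrow> nat \<Rightarrow> nat \<Rightarrow> real)
   \<Rightarrow> nat \<Rightarrow> ctree \<Rightarrow> nat \<Rightarrow> real" where
  "theta N s al ga q (Node c []) i = (if c = q then 1 else 0)"
| "theta N s al ga q (Node c [t1]) i = (if c = q then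
     (\<Sum>m\<in>{1..N}. \<Sum>j\<in>{1..s m}. (al q m i j + ga q m i j) * theta N s al ga m t1 j) else 0)"
| "theta N s al ga q (Node c (t1 # t2 # ts)) i = (if c = q then
     prod_list (map (\<lambda>t. \<Sum>m\<in>{1..N}. \<Sum>j\<in>{1..s m}. al q m i j * theta N s al ga m t j) (t1 # t2 # ts))
     else 0)"

end

theory Submission
  imports Defs "HOL-Library.Landau_Symbols"
begin

text \<open>
  Sufficiency: both the stages and the exact solution are expanded into B-series, i.e. sums over
  coloured trees of elementary differentials. Since the children of a node form a list, these are
  sums over ordered trees, and the Taylor coefficient \<open>1 / L!\<close> at every node with \<open>L\<close> children takes
  the place of the usual symmetry coefficients. Substituting an expansion that is valid up to order
  \<open>n\<close> into the stage equations (or into the differential equation, followed by an integration) yields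
  the one of order \<open>n + 1\<close>; the start is that stages and increments are \<open>O(h)\<close>, which for the stages
  uses that the implicit part is block triangular in the stage index.

  Necessity: take one unknown per tree \<open>u\<close> with at most \<open>p\<close> vertices and the system in which the
  derivative of \<open>u\<close> is the product of its children, contributed by the field of the root colour of \<open>u\<close>.
  From the initial value 0 the exact solution is \<open>h ^ rho u / dens u\<close> and the stages are exactly
  \<open>h ^ rho u * theta u\<close>, because the Jacobian at 0 only sees the trees whose root has one child.
\<close>

section \<open>Taylor expansion in coordinates\<close>

text \<open>Only partial derivatives are given, so the coordinates are moved one at a time: the
  increment of \<open>G\<close> telescopes, and each summand is treated by the mean value theorem in
  one variable together with the continuity of \<open>D k\<close>.\<close>

lemma line_derivative:
  fixes G :: "(nat \<Rightarrow> real) \<Rightarrow> real" and D :: "nat \<Rightarrow> (nat \<Rightarrow> real) \<Rightarrow> real"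
  assumes dep: "coord_dep d G"
    and der: "\<And>j x t. j < d \<Longrightarrow> ((\<lambda>t. G (x(j := t))) has_real_derivative D j (x(j := t))) (at t)"
    and cont: "\<And>j. j < d \<Longrightarrow> coord_cont d (D j)"
  shows "((\<lambda>t. G (\<lambda>c. x c + t * v c)) has_real_derivative
           (\<Sum>j<d. v j * D j (\<lambda>c. x c + t * v c))) (at t)"
proof -
  define z where "z = (\<lambda>c. x c + t * v c)"
  \<comment> \<open>The first \<open>k\<close> coordinates are moved; \<open>Z k r\<close> and
    \<open>Z (Suc k) r\<close> differ in coordinate \<open>k\<close> only, and \<open>Z d r\<close>
    agrees with the full displacement below \<open>d\<close>.\<close>
  define Z where "Z k r = (\<lambda>c. if c < k then z c + r * v c else z c)" for k :: nat and r :: real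
  have step: "((\<lambda>r. G (Z (Suc k) r) - G (Z k r)) has_real_derivative v k * D k z) (at 0)"
    if k: "k < d" for k
  proof -
    have mvt: "\<exists>\<xi>. (\<forall>c. \<bar>\<xi> c - z c\<bar> \<le> \<bar>h\<bar> * \<bar>v c\<bar>) \<and>
        G (Z (Suc k) h) - G (Z k h) = h * (v k * D k \<xi>)" for h
    proof -
      \<comment> \<open>The segment from \<open>Z k h\<close> to \<open>Z (Suc k) h\<close> is
        parametrised over [0, 1], so that the signs of \<open>h\<close> and \<open>v k\<close> do
        not matter.\<close>
      define \<phi> where "\<phi> = (\<lambda>\<tau>. G ((Z k h)(k := z k + \<tau> * (h * v k))))"
      have d\<phi>: "(\<phi> has_real_derivative
          D k ((Z k h)(k := z k + \<tau> * (h * v k))) * (h * v k)) (at \<tau>)" for \<tau>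
        unfolding \<phi>_def
        by (rule DERIV_chain2[OF der[OF k]]) (auto intro!: derivative_eq_intros)
      obtain \<tau> where \<tau>: "0 < \<tau>" "\<tau> < 1"
        "\<phi> 1 - \<phi> 0 = D k ((Z k h)(k := z k + \<tau> * (h * v k))) * (h * v k)"
        using MVT2[of 0 1 \<phi> "\<lambda>\<tau>. D k ((Z k h)(k := z k + \<tau> * (h * v k))) * (h * v k)"] d\<phi>
        by auto
      have "(Z k h)(k := z k + 1 * (h * v k)) = Z (Suc k) h"
        by (auto simp: Z_def less_Suc_eq)
      moreover have "(Z k h)(k := z k + 0 * (h * v k)) = Z k h"
        by (auto simp: Z_def)
      ultimately have "G (Z (Suc k) h) - G (Z k h)
          = h * (v k * D k ((Z k h)(k := z k + \<tau> * (h * v k))))"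
        using \<tau>(3) by (simp add: \<phi>_def)
      moreover have "\<bar>((Z k h)(k := z k + \<tau> * (h * v k))) c - z c\<bar> \<le> \<bar>h\<bar> * \<bar>v c\<bar>" for c
      proof -
        have "\<bar>\<tau>\<bar> * (\<bar>h\<bar> * \<bar>v k\<bar>) \<le> 1 * (\<bar>h\<bar> * \<bar>v k\<bar>)"
          using \<tau> by (intro mult_right_mono) auto
        then show ?thesis by (auto simp: Z_def abs_mult)
      qed
      ultimately show ?thesis by blast
    qed
    have "((\<lambda>h. (G (Z (Suc k) h) - G (Z k h)) / h) \<longlongrightarrow> v k * D k z) (at 0)"
    proof (rule tendstoI)
      fix e :: real assume e: "e > 0"
      \<comment> \<open>This bound gets multiplied by \<open>\<bar>v k\<bar>\<close> later; the
        added 1 keeps the quotient defined and the final inequality strict.\<close>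
      then have "e / (\<bar>v k\<bar> + 1) > 0" by simp
      then obtain del where del: "del > 0"
        "\<And>x'. (\<forall>c<d. \<bar>x' c - z c\<bar> < del) \<Longrightarrow> \<bar>D k x' - D k z\<bar> < e / (\<bar>v k\<bar> + 1)"
        using cont[OF k] unfolding coord_cont_def by meson
      \<comment> \<open>Dominates every \<open>\<bar>v c\<bar>\<close> with \<open>c < d\<close>, so
        \<open>\<bar>h\<bar> < del / V\<close> puts the intermediate point within \<open>del\<close>
        of \<open>z\<close>.\<close>
      define V where "V = (\<Sum>c<d. \<bar>v c\<bar>) + 1"
      have V: "V > 0" unfolding V_def by (simp add: sum_nonneg add_nonneg_pos)
      have V_le: "\<bar>v c\<bar> \<le> V" if "c < d" for c
        using member_le_sum[of c "{..<d}" "\<lambda>c. \<bar>v c\<bar>"] that by (auto simp: V_def)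
      have "\<forall>\<^sub>F h in at 0. dist h 0 < del / V"
        unfolding eventually_at using del(1) V by (intro exI[of _ "del / V"]) auto
      moreover have "\<forall>\<^sub>F h::real in at 0. h \<noteq> 0"
        by (rule eventually_neq_at_within)
      ultimately show "\<forall>\<^sub>F h in at 0. dist ((G (Z (Suc k) h) - G (Z k h)) / h) (v k * D k z) < e"
      proof eventually_elim
        case (elim h)
        obtain \<xi> where \<xi>: "\<And>c. \<bar>\<xi> c - z c\<bar> \<le> \<bar>h\<bar> * \<bar>v c\<bar>"
          "G (Z (Suc k) h) - G (Z k h) = h * (v k * D k \<xi>)"
          using mvt by blast
        have "\<bar>\<xi> c - z c\<bar> < del" if "c < d" for c
        proof -
          have "\<bar>\<xi> c - z c\<bar> \<le> \<bar>h\<bar> * V"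
            using \<xi>(1)[of c] mult_left_mono[OF V_le[OF that], of "\<bar>h\<bar>"] by simp
          also have "\<dots> < del" using elim V by (simp add: field_simps)
          finally show ?thesis .
        qed
        then have *: "\<bar>D k \<xi> - D k z\<bar> < e / (\<bar>v k\<bar> + 1)" using del(2) by blast
        have "dist ((G (Z (Suc k) h) - G (Z k h)) / h) (v k * D k z) = \<bar>v k\<bar> * \<bar>D k \<xi> - D k z\<bar>"
          using \<xi>(2) elim by (simp add: dist_real_def abs_mult flip: right_diff_distrib)
        also have "\<dots> \<le> \<bar>v k\<bar> * (e / (\<bar>v k\<bar> + 1))"
          using * by (intro mult_left_mono) auto
        also have "\<dots> < e" using e by (simp add: field_simps)
        finally show ?case .
      qed
    qed
    moreover have "Z (Suc k) 0 = Z k 0" by (auto simp: Z_def)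
    ultimately show ?thesis by (simp add: DERIV_def)
  qed
  have main: "((\<lambda>r. G (Z k r)) has_real_derivative (\<Sum>j<k. v j * D j z)) (at 0)" if "k \<le> d" for k
    using that
  proof (induction k)
    case 0
    then show ?case by (simp add: Z_def)
  next
    case (Suc k)
    have "((\<lambda>r. G (Z k r) + (G (Z (Suc k) r) - G (Z k r))) has_real_derivative
        (\<Sum>j<k. v j * D j z) + v k * D k z) (at 0)"
      using Suc by (intro DERIV_add step) auto
    then show ?case by simp
  qed
  have "G (Z d r) = G (\<lambda>c. x c + (t + r) * v c)" for r
    using dep unfolding coord_dep_def by (auto simp: Z_def z_def algebra_simps)
  then have "((\<lambda>r. G (\<lambda>c. x c + (t + r) * v c)) has_real_derivative (\<Sum>j<d. v j * D j z)) (at 0)"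
    using main[of d] by simp
  then show ?thesis
    unfolding z_def DERIV_def by simp
qed

section \<open>Iterated partial derivatives, multilinear forms and Taylor's formula\<close>

lemma smooth_fun_pd_deriv:
  assumes "smooth_fun d g" "set js \<subseteq> {..<d}" "j < d"
  shows "((\<lambda>t. pd g js (x(j := t))) has_real_derivative pd g (j # js) (x(j := t))) (at t)"
proof -
  have "(\<lambda>r. pd g js ((x(j := t))(j := r))) differentiable (at ((x(j := t)) j))"
    using assms unfolding smooth_fun_def by blast
  then show ?thesis by (simp add: DERIV_deriv_iff_real_differentiable[symmetric])
qed

lemma coord_dep_pd:
  assumes "coord_dep d g" "set js \<subseteq> {..<d}"
  shows "coord_dep d (pd g js)"
  using assms(2)
proof (induction js)
  case Nil
  then show ?case using assms(1) by simp
next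
  case (Cons j js)
  show ?case unfolding coord_dep_def
  proof (intro allI impI)
    fix x x' :: "nat \<Rightarrow> real" assume eq: "\<forall>c<d. x c = x' c"
    have "pd g js (x(j := t)) = pd g js (x'(j := t))" for t
      using Cons eq unfolding coord_dep_def by simp
    then show "pd g (j # js) x = pd g (j # js) x'"
      using eq Cons.prems by simp
  qed
qed

text \<open>The multilinear form with coefficient tensor \<open>P\<close>: the sum over all index lists \<open>js\<close> below \<open>d\<close> of
  \<open>P js\<close> times the product of the entries \<open>u j\<close>.\<close>
fun mlin :: "nat \<Rightarrow> (nat list \<Rightarrow> real) \<Rightarrow> (nat \<Rightarrow> real) list \<Rightarrow> real" where
  "mlin d P [] = P []"
| "mlin d P (u # us) = (\<Sum>j<d. u j * mlin d (\<lambda>js. P (j # js)) us)"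

text \<open>Linearity in the tensor. With \<open>a = v\<close> and
  \<open>Q j js = P (j # js)\<close> it turns a tensor differentiated along \<open>v\<close> into
  the form with one more argument \<open>v\<close>.\<close>

lemma mlin_sum: "mlin d (\<lambda>js. \<Sum>i\<in>I. a i * Q i js) us = (\<Sum>i\<in>I. a i * mlin d (Q i) us)"
proof (induction us arbitrary: Q)
  case (Cons u us)
  have "mlin d (\<lambda>js. \<Sum>i\<in>I. a i * Q i js) (u # us) = (\<Sum>j<d. \<Sum>i\<in>I. a i * (u j * mlin d (\<lambda>js. Q i (j # js)) us))"
    by (simp add: Cons sum_distrib_left algebra_simps)
  also have "\<dots> = (\<Sum>i\<in>I. a i * mlin d (Q i) (u # us))"
    by (subst sum.swap) (simp add: sum_distrib_left)
  finally show ?case .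
qed simp

lemma mlin_deriv:
  assumes "\<And>js. set js \<subseteq> {..<d} \<Longrightarrow> ((\<lambda>t. P t js) has_real_derivative P' js) (at t)"
  shows "((\<lambda>t. mlin d (P t) us) has_real_derivative mlin d P' us) (at t)"
  using assms
proof (induction us arbitrary: P P')
  case (Cons u us)
  show ?case unfolding mlin.simps
    by (intro DERIV_sum DERIV_cmult Cons) auto
qed simp

lemma mlin_bound:
  assumes "\<And>js. set js \<subseteq> {..<d} \<Longrightarrow> length js = L \<Longrightarrow> \<bar>P js\<bar> \<le> B"
  shows "\<bar>mlin d P (replicate L v)\<bar> \<le> B * (\<Sum>c<d. \<bar>v c\<bar>) ^ L"
  using assms
proof (induction L arbitrary: P)
  case (Suc L)
  have "\<bar>mlin d P (replicate (Suc L) v)\<bar> \<le> (\<Sum>j<d. \<bar>v j * mlin d (\<lambda>js. P (j # js)) (replicate L v)\<bar>)"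
    by simp
  also have "\<dots> \<le> (\<Sum>j<d. \<bar>v j\<bar> * (B * (\<Sum>c<d. \<bar>v c\<bar>) ^ L))"
    unfolding abs_mult by (intro sum_mono mult_left_mono Suc) auto
  also have "\<dots> = B * (\<Sum>c<d. \<bar>v c\<bar>) ^ Suc L"
    by (simp add: sum_distrib_right[symmetric])
  finally show ?case .
qed simp

text \<open>Continuity at the single point \<open>y\<close> bounds each function near
  \<open>y\<close>; as \<open>S\<close> is finite, the least radius and the largest bound serve for
  all. It controls the derivatives in the Taylor remainder.\<close>

lemma coord_cont_locally_bounded:
  assumes "finite S" "\<And>j. j \<in> S \<Longrightarrow> coord_cont d (P j)"
  shows "\<exists>r>0. \<exists>B. \<forall>x. (\<forall>c<d. \<bar>x c - y c\<bar> < r) \<longrightarrow> (\<forall>j\<in>S. \<bar>P j x\<bar> \<le> B)"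
  using assms
proof (induction S rule: finite_induct)
  case empty
  then show ?case by (auto intro: exI[of _ 1])
next
  case (insert a S)
  then obtain r B where 1: "r > 0" "\<And>x j. (\<forall>c<d. \<bar>x c - y c\<bar> < r) \<Longrightarrow> j \<in> S \<Longrightarrow> \<bar>P j x\<bar> \<le> B"
    by blast
  obtain r' where 2: "r' > 0" "\<And>x. (\<forall>c<d. \<bar>x c - y c\<bar> < r') \<Longrightarrow> \<bar>P a x - P a y\<bar> < 1"
    using insert(4)[of a] unfolding coord_cont_def by (metis insertI1 zero_less_one)
  show ?case
  proof (rule exI[of _ "min r r'"], intro exI[of _ "max B (\<bar>P a y\<bar> + 1)"] conjI allI impI ballI)
    show "min r r' > 0" using 1 2 by simp
    fix x j assume x: "\<forall>c<d. \<bar>x c - y c\<bar> < min r r'" and j: "j \<in> insert a S"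
    show "\<bar>P j x\<bar> \<le> max B (\<bar>P a y\<bar> + 1)"
      using 1(2)[of x j] 2(2)[of x] x j by fastforce
  qed
qed

text \<open>Maclaurin's formula in one variable along the segment from \<open>y\<close> to
  \<open>y + v\<close>: the tensor of all \<open>L\<close>-th partial derivatives, contracted with
  \<open>L\<close> copies of \<open>v\<close>, is the \<open>L\<close>-th derivative in that
  direction.\<close>

lemma smooth_fun_taylor:
  assumes g: "smooth_fun d g"
  shows "\<exists>r>0. \<exists>B. \<forall>v. (\<forall>c<d. \<bar>v c\<bar> < r) \<longrightarrow>
    \<bar>g (\<lambda>c. y c + v c) - (\<Sum>L\<le>n. mlin d (\<lambda>js. pd g js y) (replicate L v) / fact L)\<bar>
      \<le> B * (\<Sum>c<d. \<bar>v c\<bar>) ^ Suc n"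
proof -
  have "\<exists>r>0. \<exists>B. \<forall>x. (\<forall>c<d. \<bar>x c - y c\<bar> < r) \<longrightarrow>
      (\<forall>js\<in>{js. set js \<subseteq> {..<d} \<and> length js = Suc n}. \<bar>pd g js x\<bar> \<le> B)"
    using g by (intro coord_cont_locally_bounded finite_lists_length_eq) (auto simp: smooth_fun_def)
  then obtain r B where r: "r > 0" and B: "\<And>x js. (\<forall>c<d. \<bar>x c - y c\<bar> < r) \<Longrightarrow>
      set js \<subseteq> {..<d} \<Longrightarrow> length js = Suc n \<Longrightarrow> \<bar>pd g js x\<bar> \<le> B"
    by blast
  show ?thesis
  proof (rule exI[of _ r], intro exI[of _ "B / fact (Suc n)"] conjI allI impI r)
    fix v :: "nat \<Rightarrow> real" assume v: "\<forall>c<d. \<bar>v c\<bar> < r"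
    define \<phi> where "\<phi> L t = mlin d (\<lambda>js. pd g js (\<lambda>c. y c + t * v c)) (replicate L v)" for L t
    have pdl: "((\<lambda>t. pd g js (\<lambda>c. y c + t * v c)) has_real_derivative
       (\<Sum>j<d. v j * pd g (j # js) (\<lambda>c. y c + t * v c))) (at t)" if "set js \<subseteq> {..<d}" for js t
    proof (rule line_derivative)
      show "coord_dep d (pd g js)"
        using g that by (intro coord_dep_pd) (auto simp: smooth_fun_def)
      show "coord_cont d (pd g (j # js))" if "j < d" for j
        using g that \<open>set js \<subseteq> {..<d}\<close> unfolding smooth_fun_def by (auto simp del: pd.simps)
    qed (use smooth_fun_pd_deriv[OF g that] in blast)
    have d\<phi>: "(\<phi> L has_real_derivative \<phi> (Suc L) t) (at t)" for L t
    proof -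
      have "(\<phi> L has_real_derivative
          mlin d (\<lambda>js. \<Sum>j<d. v j * pd g (j # js) (\<lambda>c. y c + t * v c)) (replicate L v)) (at t)"
        unfolding \<phi>_def by (rule mlin_deriv) (rule pdl)
      then show ?thesis by (simp add: \<phi>_def mlin_sum del: pd.simps)
    qed
    have "\<exists>t>0. t < 1 \<and> \<phi> 0 1 = (\<Sum>m<Suc n. \<phi> m 0 / fact m * 1 ^ m) + \<phi> (Suc n) t / fact (Suc n) * 1 ^ Suc n"
      by (rule Maclaurin) (use d\<phi> in auto)
    then obtain t where t: "0 < t" "t < 1"
      "\<phi> 0 1 = (\<Sum>m\<le>n. \<phi> m 0 / fact m) + \<phi> (Suc n) t / fact (Suc n)"
      by (auto simp: lessThan_Suc_atMost)
    have "\<bar>\<phi> (Suc n) t\<bar> \<le> B * (\<Sum>c<d. \<bar>v c\<bar>) ^ Suc n"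
      unfolding \<phi>_def
    proof (intro mlin_bound B)
      show "\<forall>c<d. \<bar>y c + t * v c - y c\<bar> < r"
      proof (intro allI impI)
        fix c assume "c < d"
        have "\<bar>t\<bar> * \<bar>v c\<bar> \<le> 1 * \<bar>v c\<bar>" using t by (intro mult_right_mono) auto
        then show "\<bar>y c + t * v c - y c\<bar> < r"
          using v \<open>c < d\<close> by (force simp: abs_mult)
      qed
    qed auto
    then have "\<bar>\<phi> (Suc n) t / fact (Suc n)\<bar> \<le> B / fact (Suc n) * (\<Sum>c<d. \<bar>v c\<bar>) ^ Suc n"
      unfolding abs_divide by (simp add: divide_right_mono)
    moreover have "\<phi> 0 1 = g (\<lambda>c. y c + v c)" by (simp add: \<phi>_def)
    ultimately show "\<bar>g (\<lambda>c. y c + v c) - (\<Sum>L\<le>n. mlin d (\<lambda>js. pd g js y) (replicate L v) / fact L)\<bar>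
      \<le> B / fact (Suc n) * (\<Sum>c<d. \<bar>v c\<bar>) ^ Suc n"
      using t(3) by (simp add: \<phi>_def)
  qed
qed

section \<open>Sums over trees and forests\<close>

definition trees :: "nat \<Rightarrow> nat \<Rightarrow> ctree set" where
  "trees N n = {t. colors_ok N t \<and> rho t \<le> n}"

definition forests :: "nat \<Rightarrow> nat \<Rightarrow> ctree list set" where
  "forests N n = {ts. (\<forall>t\<in>set ts. colors_ok N t) \<and> sum_list (map rho ts) \<le> n}"

lemma rho_pos: "1 \<le> rho t"
  by (cases t) simp

lemma length_le_sum_rho: "length ts \<le> sum_list (map rho ts)"
proof (induction ts)
  case (Cons t ts)
  then show ?case using rho_pos[of t] by simp
qed simp

lemma trees_0: "trees N 0 = {}"
proof -
  have "rho t \<noteq> 0" for t using rho_pos[of t] by simp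
  then show ?thesis by (simp add: trees_def)
qed

text \<open>Cutting off the root costs one vertex. This shift by one matches the factor
  \<open>h\<close> gained from a stage equation or from an integration.\<close>

lemma trees_Suc: "trees N (Suc n) = (\<lambda>(m, ts). Node m ts) ` ({1..N} \<times> forests N n)"
proof -
  have "t \<in> trees N (Suc n) \<longleftrightarrow> t \<in> (\<lambda>(m, ts). Node m ts) ` ({1..N} \<times> forests N n)" for t
    by (cases t) (auto simp: trees_def forests_def image_iff)
  then show ?thesis by blast
qed

lemma forests_subset: "forests N n \<subseteq> {ts. set ts \<subseteq> trees N n \<and> length ts \<le> n}"
proof
  fix ts assume ts: "ts \<in> forests N n"
  have "rho t \<le> n" if "t \<in> set ts" for t
    using member_le_sum_list[of "rho t" "map rho ts"] that ts by (force simp: forests_def)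
  then show "ts \<in> {ts. set ts \<subseteq> trees N n \<and> length ts \<le> n}"
    using ts length_le_sum_rho[of ts] by (auto simp: forests_def trees_def)
qed

text \<open>Every tree has a vertex, so a forest with at most \<open>n\<close> vertices is a list of
  length at most \<open>n\<close> over \<open>trees N n\<close>; adding a root leads to the trees of
  the next size.\<close>

lemma finite_trees: "finite (trees N n)"
proof (induction n)
  case (Suc n)
  have "finite (forests N n)"
    by (rule finite_subset[OF forests_subset finite_lists_length_le[OF Suc]])
  then show ?case unfolding trees_Suc by (intro finite_imageI finite_cartesian_product) auto
qed (simp add: trees_0)

lemma finite_forests: "finite (forests N n)"
  by (rule finite_subset[OF forests_subset finite_lists_length_le[OF finite_trees]])

lemma sum_trees_Suc:
  "(\<Sum>t\<in>trees N (Suc n). G t) = (\<Sum>m\<in>{1..N}. \<Sum>ts\<in>forests N n. G (Node m ts))"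
proof -
  have "inj_on (\<lambda>(m, ts). Node m ts) ({1..N} \<times> forests N n)"
    by (auto simp: inj_on_def)
  then show ?thesis
    unfolding trees_Suc by (simp add: sum.reindex sum.cartesian_product o_def case_prod_unfold)
qed

section \<open>Asymptotic expansions indexed by trees and forests\<close>

lemma bigo_power_mono:
  fixes H :: "'a \<Rightarrow> real"
  assumes H: "(H \<longlongrightarrow> 0) F" and "m \<le> n"
  shows "(\<lambda>x. H x ^ n) \<in> O[F](\<lambda>x. H x ^ m)"
proof (rule bigoI[of _ 1])
  have "\<forall>\<^sub>F x in F. dist (H x) 0 < 1" using tendstoD[OF H] by simp
  then show "\<forall>\<^sub>F x in F. norm (H x ^ n) \<le> 1 * norm (H x ^ m)"
    by eventually_elim (use assms(2) in \<open>simp add: power_abs power_decreasing\<close>)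
qed

text \<open>Rests on \<open>u * v - u' * v' = (u - u') * v + u' * (v - v')\<close>; here
  \<open>v\<close> is bounded because \<open>v'\<close> and the error \<open>g\<close> are.\<close>

lemma bigo_mult_approx:
  fixes u v u' v' g :: "'a \<Rightarrow> real"
  assumes "(\<lambda>x. u x - u' x) \<in> O[F](g)" "(\<lambda>x. v x - v' x) \<in> O[F](g)"
    and "u' \<in> O[F](\<lambda>_. 1)" "v' \<in> O[F](\<lambda>_. 1)" "g \<in> O[F](\<lambda>_. 1)"
  shows "(\<lambda>x. u x * v x - u' x * v' x) \<in> O[F](g)"
proof -
  have v: "v \<in> O[F](\<lambda>_. 1)"
    using sum_in_bigo(1)[OF landau_o.big_trans[OF assms(2,5)] assms(4)] by simp
  have "(\<lambda>x. (u x - u' x) * v x) \<in> O[F](g)" "(\<lambda>x. u' x * (v x - v' x)) \<in> O[F](g)"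
    using landau_o.big.mult[OF assms(1) v] landau_o.big.mult[OF assms(3,2)] by simp_all
  from sum_in_bigo(1)[OF this] show ?thesis by (simp add: algebra_simps)
qed

text \<open>Induction on the number of arguments: the first contributes a tree, the others a forest,
  and the product of both expansions is truncated again at \<open>n\<close> vertices.
  \<open>P\<close> varies because fixing the first index changes the tensor.\<close>

lemma mlin_replicate_expansion:
  fixes H :: "'a \<Rightarrow> real" and \<delta> :: "'a \<Rightarrow> nat \<Rightarrow> real" and E :: "ctree \<Rightarrow> nat \<Rightarrow> real"
  assumes H: "(H \<longlongrightarrow> 0) F"
    and \<delta>: "\<And>c. c < d \<Longrightarrow>
      (\<lambda>x. \<delta> x c - (\<Sum>t\<in>trees N n. H x ^ rho t * A t * E t c)) \<in> O[F](\<lambda>x. H x ^ Suc n)"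
  shows "(\<lambda>x. mlin d P (replicate L (\<delta> x)) -
      (\<Sum>ts | ts \<in> forests N n \<and> length ts = L.
         H x ^ sum_list (map rho ts) * prod_list (map A ts) * mlin d P (map E ts)))
    \<in> O[F](\<lambda>x. H x ^ Suc n)"
proof (induction L arbitrary: P)
  case 0
  have "{ts \<in> forests N n. length ts = 0} = {[]}" by (auto simp: forests_def)
  then show ?case by simp
next
  case (Suc L)
  define FL where "FL l = {ts. ts \<in> forests N n \<and> length ts = l}" for l
  have fin: "finite (FL l)" for l unfolding FL_def by (simp add: finite_forests)
  define R where "R x t ts = H x ^ (rho t + sum_list (map rho ts)) * (A t * prod_list (map A ts))
      * mlin d P (E t # map E ts)" for x t ts
  define S where "S x j = (\<Sum>t\<in>trees N n. H x ^ rho t * A t * E t j)" for x j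
  define M where "M x j = (\<Sum>ts\<in>FL L.
      H x ^ sum_list (map rho ts) * prod_list (map A ts) * mlin d (\<lambda>js. P (j # js)) (map E ts))" for x j
  have pow1: "(\<lambda>x. H x ^ k) \<in> O[F](\<lambda>_. 1)" for k
    using bigo_power_mono[OF H, of 0 k] by simp
  have b1: "(\<lambda>x. H x ^ k * a) \<in> O[F](\<lambda>_. 1)" for k a
    using landau_o.big.mult[OF pow1[of k] bigo_const[of a]] by simp
  have 1: "(\<lambda>x. \<Sum>j<d. (\<delta> x j * mlin d (\<lambda>js. P (j # js)) (replicate L (\<delta> x)) - S x j * M x j))
      \<in> O[F](\<lambda>x. H x ^ Suc n)"
  proof (rule big_sum_in_bigo, rule bigo_mult_approx)
    fix j assume "j \<in> {..<d}"
    then show "(\<lambda>x. \<delta> x j - S x j) \<in> O[F](\<lambda>x. H x ^ Suc n)" using \<delta> by (simp add: S_def)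
    show "(\<lambda>x. mlin d (\<lambda>js. P (j # js)) (replicate L (\<delta> x)) - M x j) \<in> O[F](\<lambda>x. H x ^ Suc n)"
      using Suc[of "\<lambda>js. P (j # js)"] by (simp add: M_def FL_def)
    show "(\<lambda>x. S x j) \<in> O[F](\<lambda>_. 1)" "(\<lambda>x. M x j) \<in> O[F](\<lambda>_. 1)"
      unfolding S_def M_def by (intro big_sum_in_bigo; use b1 in \<open>simp add: mult.assoc\<close>)+
  qed (rule pow1)
  have SM: "(\<Sum>j<d. S x j * M x j) = (\<Sum>(t, ts)\<in>trees N n \<times> FL L. R x t ts)" for x
  proof -
    have "(\<Sum>j<d. S x j * M x j) = (\<Sum>j<d. \<Sum>(t, ts)\<in>trees N n \<times> FL L.
        H x ^ (rho t + sum_list (map rho ts)) * (A t * prod_list (map A ts)) *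
          (E t j * mlin d (\<lambda>js. P (j # js)) (map E ts)))"
      unfolding S_def M_def sum_product sum.cartesian_product
      by (simp add: power_add algebra_simps case_prod_unfold)
    also have "\<dots> = (\<Sum>(t, ts)\<in>trees N n \<times> FL L. R x t ts)"
      by (subst sum.swap) (simp add: R_def sum_distrib_left case_prod_unfold)
    finally show ?thesis .
  qed
  \<comment> \<open>The surviving terms: consing maps these pairs bijectively onto the forests of
    \<open>Suc L\<close> trees. All other pairs carry at least the power \<open>Suc n\<close> of
    \<open>H\<close> and join the error.\<close>
  define lo where "lo = {(t, ts)\<in>trees N n \<times> FL L. rho t + sum_list (map rho ts) \<le> n}"
  have "(\<lambda>(t, ts). t # ts) ` lo = FL (Suc L)"
  proof (intro equalityI subsetI)
    fix ts assume "ts \<in> FL (Suc L)"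
    then show "ts \<in> (\<lambda>(t, ts). t # ts) ` lo"
      by (cases ts) (auto simp: FL_def lo_def forests_def trees_def image_iff)
  qed (auto simp: FL_def lo_def forests_def trees_def)
  moreover have "inj_on (\<lambda>(t, ts). t # ts) lo" by (auto simp: inj_on_def)
  ultimately have lo: "(\<Sum>ts\<in>FL (Suc L).
         H x ^ sum_list (map rho ts) * prod_list (map A ts) * mlin d P (map E ts))
      = (\<Sum>(t, ts)\<in>lo. R x t ts)" for x
    using sum.reindex[of "\<lambda>(t, ts). t # ts" lo "\<lambda>ts. H x ^ sum_list (map rho ts) *
        prod_list (map A ts) * mlin d P (map E ts)"]
    by (simp add: R_def case_prod_unfold)
  have "(\<lambda>x. \<Sum>(t, ts)\<in>trees N n \<times> FL L - lo. R x t ts) \<in> O[F](\<lambda>x. H x ^ Suc n)"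
    unfolding case_prod_unfold
  proof (rule big_sum_in_bigo)
    fix z assume "z \<in> trees N n \<times> FL L - lo"
    then have "Suc n \<le> rho (fst z) + sum_list (map rho (snd z))" by (auto simp: lo_def)
    from landau_o.big.mult[OF bigo_power_mono[OF H this] bigo_const]
    show "(\<lambda>x. R x (fst z) (snd z)) \<in> O[F](\<lambda>x. H x ^ Suc n)"
      unfolding R_def mult.assoc by simp
  qed
  moreover have "(\<Sum>(t, ts)\<in>trees N n \<times> FL L - lo. R x t ts) =
     (\<Sum>j<d. S x j * M x j) - (\<Sum>(t, ts)\<in>lo. R x t ts)" for x
    unfolding SM by (intro sum_diff finite_cartesian_product fin finite_trees) (auto simp: lo_def)
  ultimately have 2: "(\<lambda>x. (\<Sum>j<d. S x j * M x j) - (\<Sum>(t, ts)\<in>lo. R x t ts)) \<in> O[F](\<lambda>x. H x ^ Suc n)"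
    by simp
  show ?case
    using sum_in_bigo(1)[OF 1 2] unfolding lo[symmetric] FL_def[symmetric]
    by (simp add: sum_subtractf)
qed

text \<open>Taylor's formula in which each homogeneous term is expanded separately; summing over the
  degree \<open>L\<close> collects the forests of every length.\<close>

lemma smooth_fun_tree_expansion:
  fixes H :: "'a \<Rightarrow> real" and \<delta> :: "'a \<Rightarrow> nat \<Rightarrow> real" and E :: "ctree \<Rightarrow> nat \<Rightarrow> real"
  assumes H: "(H \<longlongrightarrow> 0) F" and g: "smooth_fun d g"
    and \<delta>: "\<And>c. c < d \<Longrightarrow>
      (\<lambda>x. \<delta> x c - (\<Sum>t\<in>trees N n. H x ^ rho t * A t * E t c)) \<in> O[F](\<lambda>x. H x ^ Suc n)"
  shows "(\<lambda>x. g (\<lambda>c. y c + \<delta> x c) -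
      (\<Sum>ts\<in>forests N n. H x ^ sum_list (map rho ts) *
         (prod_list (map A ts) / fact (length ts)) * mlin d (\<lambda>js. pd g js y) (map E ts)))
    \<in> O[F](\<lambda>x. H x ^ Suc n)"
proof -
  define P where "P = (\<lambda>js. pd g js y)"
  \<comment> \<open>Each tree has at least one vertex, so the increment is \<open>O(H)\<close>.
    Hence it eventually lies within the Taylor radius, and the Taylor remainder is
    \<open>O(H ^ Suc n)\<close>.\<close>
  have \<delta>1: "(\<lambda>x. \<delta> x c) \<in> O[F](H)" if "c < d" for c
  proof -
    have "(\<lambda>x. H x ^ rho t * A t * E t c) \<in> O[F](H)" for t
      using landau_o.big.mult[OF bigo_power_mono[OF H rho_pos[of t]] bigo_const[of "A t * E t c"]]
      by (simp add: mult.assoc)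
    moreover have "(\<lambda>x. \<delta> x c - (\<Sum>t\<in>trees N n. H x ^ rho t * A t * E t c)) \<in> O[F](H)"
      using landau_o.big_trans[OF \<delta>[OF that] bigo_power_mono[OF H, of 1 "Suc n"]] by simp
    ultimately show ?thesis
      using sum_in_bigo(1)[of "\<lambda>x. \<delta> x c - (\<Sum>t\<in>trees N n. H x ^ rho t * A t * E t c)" F H
          "\<lambda>x. \<Sum>t\<in>trees N n. H x ^ rho t * A t * E t c"]
      by (simp add: big_sum_in_bigo)
  qed
  obtain r B where r: "r > 0" and B: "\<And>v. (\<forall>c<d. \<bar>v c\<bar> < r) \<Longrightarrow>
    \<bar>g (\<lambda>c. y c + v c) - (\<Sum>L\<le>n. mlin d P (replicate L v) / fact L)\<bar>
      \<le> B * (\<Sum>c<d. \<bar>v c\<bar>) ^ Suc n"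
    using smooth_fun_taylor[OF g, of y n] unfolding P_def by blast
  have "(\<lambda>x. \<Sum>c<d. \<bar>\<delta> x c\<bar>) \<in> O[F](H)"
    using \<delta>1 by (intro big_sum_in_bigo) simp
  then have "(\<lambda>x. (\<Sum>c<d. \<bar>\<delta> x c\<bar>) ^ Suc n) \<in> O[F](\<lambda>x. H x ^ Suc n)"
    by (rule landau_o.big_power)
  moreover have "(\<lambda>x. g (\<lambda>c. y c + \<delta> x c) - (\<Sum>L\<le>n. mlin d P (replicate L (\<delta> x)) / fact L))
     \<in> O[F](\<lambda>x. (\<Sum>c<d. \<bar>\<delta> x c\<bar>) ^ Suc n)"
  proof (rule bigoI[of _ B])
    have "((\<lambda>x. \<delta> x c) \<longlongrightarrow> 0) F" if "c < d" for c
    proof -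
      have "H \<in> o[F](\<lambda>_. 1)" using H by (intro smalloI_tendsto) auto
      with \<delta>1[OF that] have "(\<lambda>x. \<delta> x c) \<in> o[F](\<lambda>_. 1)" by (rule landau_o.big_small_trans)
      then show ?thesis using smalloD_tendsto by fastforce
    qed
    then have "\<forall>\<^sub>F x in F. \<bar>\<delta> x c\<bar> < r" if "c < d" for c
      using tendstoD[of "\<lambda>x. \<delta> x c" 0 F r] r that by simp
    then have "\<forall>\<^sub>F x in F. \<forall>c\<in>{..<d}. \<bar>\<delta> x c\<bar> < r"
      by (intro eventually_ball_finite) auto
    then show "\<forall>\<^sub>F x in F. norm (g (\<lambda>c. y c + \<delta> x c) - (\<Sum>L\<le>n. mlin d P (replicate L (\<delta> x)) / fact L))
        \<le> B * norm ((\<Sum>c<d. \<bar>\<delta> x c\<bar>) ^ Suc n)"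
      by eventually_elim (use B in \<open>simp add: sum_nonneg\<close>)
  qed
  ultimately have 1: "(\<lambda>x. g (\<lambda>c. y c + \<delta> x c) - (\<Sum>L\<le>n. mlin d P (replicate L (\<delta> x)) / fact L))
     \<in> O[F](\<lambda>x. H x ^ Suc n)"
    by (rule landau_o.big_trans[rotated])
  define G where "G x ts = H x ^ sum_list (map rho ts) * prod_list (map A ts) * mlin d P (map E ts)" for x ts
  have "(\<lambda>x. \<Sum>L\<le>n. (mlin d P (replicate L (\<delta> x)) -
      (\<Sum>ts | ts \<in> forests N n \<and> length ts = L. G x ts)) * (1 / fact L)) \<in> O[F](\<lambda>x. H x ^ Suc n)"
  proof (rule big_sum_in_bigo)
    fix L
    show "(\<lambda>x. (mlin d P (replicate L (\<delta> x)) -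
        (\<Sum>ts | ts \<in> forests N n \<and> length ts = L. G x ts)) * (1 / fact L)) \<in> O[F](\<lambda>x. H x ^ Suc n)"
      using landau_o.big.mult[OF mlin_replicate_expansion[where d = d and P = P and L = L, OF H \<delta>] bigo_const[of "1 / fact L"]]
      unfolding G_def by simp
  qed
  then have 2: "(\<lambda>x. (\<Sum>L\<le>n. mlin d P (replicate L (\<delta> x)) / fact L) -
      (\<Sum>L\<le>n. \<Sum>ts | ts \<in> forests N n \<and> length ts = L. G x ts / fact (length ts))) \<in> O[F](\<lambda>x. H x ^ Suc n)"
    by (simp add: sum_subtractf diff_divide_distrib sum_divide_distrib)
  \<comment> \<open>A forest in \<open>forests N n\<close> has at most \<open>n\<close> trees, so
    the degrees up to \<open>n\<close> exhaust all forests.\<close>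
  have "(\<Sum>L\<le>n. \<Sum>ts | ts \<in> forests N n \<and> length ts = L. G x ts / fact (length ts))
      = (\<Sum>ts\<in>forests N n. G x ts / fact (length ts))" for x
    using forests_subset by (intro sum.group finite_forests) auto
  then have "(\<lambda>x. g (\<lambda>c. y c + \<delta> x c) - (\<Sum>ts\<in>forests N n. G x ts / fact (length ts)))
     \<in> O[F](\<lambda>x. H x ^ Suc n)"
    using sum_in_bigo(1)[OF 1 2] by simp
  then show ?thesis unfolding G_def P_def by (simp add: algebra_simps)
qed

section \<open>B-series\<close>

text \<open>Summed over the distinct orderings of an unordered tree, these weights give the
  reciprocal of the order of its symmetry group.\<close>

fun tweight :: "ctree \<Rightarrow> real" where
  "tweight (Node m ts) = prod_list (map tweight ts) / fact (length ts)"

fun elem_diff :: "nat \<Rightarrow> (nat \<Rightarrow> (nat \<Rightarrow> real) \<Rightarrow> nat \<Rightarrow> real) \<Rightarrow> (nat \<Rightarrow> real) \<Rightarrow> ctree \<Rightarrow> nat \<Rightarrow> real" where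
  "elem_diff d f y (Node m ts) =
     (\<lambda>c. mlin d (\<lambda>js. pd (\<lambda>x. f m x c) js y) (map (elem_diff d f y) ts))"

text \<open>\<open>tweight\<close> is kept apart from the coefficient \<open>A\<close>, so that
  \<open>A\<close> is the reciprocal density for the exact solution and \<open>theta\<close> for a
  stage.\<close>

definition bseries :: "nat \<Rightarrow> nat \<Rightarrow> (nat \<Rightarrow> (nat \<Rightarrow> real) \<Rightarrow> nat \<Rightarrow> real) \<Rightarrow> (nat \<Rightarrow> real)
    \<Rightarrow> nat \<Rightarrow> (ctree \<Rightarrow> real) \<Rightarrow> real \<Rightarrow> nat \<Rightarrow> real" where
  "bseries N d f y n A h c =
     (\<Sum>t\<in>trees N n. h ^ rho t * (A t * tweight t) * elem_diff d f y t c)"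

lemma bseries_0: "bseries N d f y 0 A h c = 0"
  by (simp add: bseries_def trees_0)

lemma bseries_scale: "bseries N d f y n (\<lambda>t. a * A t) h c = a * bseries N d f y n A h c"
  by (simp add: bseries_def sum_distrib_left algebra_simps)

lemma bseries_sum:
  "bseries N d f y n (\<lambda>t. \<Sum>i\<in>I. A i t) h c = (\<Sum>i\<in>I. bseries N d f y n (A i) h c)"
proof -
  have "bseries N d f y n (\<lambda>t. \<Sum>i\<in>I. A i t) h c
     = (\<Sum>t\<in>trees N n. \<Sum>i\<in>I. h ^ rho t * (A i t * tweight t) * elem_diff d f y t c)"
    unfolding bseries_def by (simp only: sum_distrib_left sum_distrib_right)
  also have "\<dots> = (\<Sum>i\<in>I. bseries N d f y n (A i) h c)"
    unfolding bseries_def by (rule sum.swap)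
  finally show ?thesis .
qed

lemma prod_list_map_mult:
  fixes u v :: "'a \<Rightarrow> real"
  shows "prod_list (map (\<lambda>x. u x * v x) xs) = prod_list (map u xs) * prod_list (map v xs)"
  by (induction xs) auto

text \<open>Substitution into \<open>f q\<close> hangs each forest below a new root of colour
  \<open>q\<close>. The power of \<open>H\<close> counts the children alone; the factor for the root
  comes from the stage equation or from integration.\<close>

lemma smooth_field_bseries:
  fixes H :: "'a \<Rightarrow> real" and \<delta> :: "'a \<Rightarrow> nat \<Rightarrow> real"
  assumes H: "(H \<longlongrightarrow> 0) F" and f: "smooth_field d (f q)" and c: "c < d"
    and \<delta>: "\<And>c. c < d \<Longrightarrow>
      (\<lambda>x. \<delta> x c - bseries N d f y n A (H x) c) \<in> O[F](\<lambda>x. H x ^ Suc n)"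
  shows "(\<lambda>x. f q (\<lambda>c. y c + \<delta> x c) c -
      (\<Sum>ts\<in>forests N n. H x ^ sum_list (map rho ts) *
         (prod_list (map A ts) * tweight (Node q ts)) * elem_diff d f y (Node q ts) c))
    \<in> O[F](\<lambda>x. H x ^ Suc n)"
proof -
  have "smooth_fun d (\<lambda>x. f q x c)" using f c by (simp add: smooth_field_def)
  from smooth_fun_tree_expansion[where A = "\<lambda>t. A t * tweight t" and E = "elem_diff d f y", OF H this
      \<delta>[unfolded bseries_def]]
  show ?thesis by (simp add: prod_list_map_mult)
qed

text \<open>As \<beta> = \<alpha> + \<gamma>, the three clauses merge: an \<open>al\<close>-product
  for any number of children, which is 1 for none, plus a \<open>ga\<close>-term for exactly one
  child. The first part will come from the field, the second from the Jacobian.\<close>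

lemma theta_Node:
  "theta N s al ga q (Node q ts) i =
     prod_list (map (\<lambda>t. \<Sum>m\<in>{1..N}. \<Sum>j\<in>{1..s m}. al q m i j * theta N s al ga m t j) ts)
     + (if length ts = 1 then \<Sum>m\<in>{1..N}. \<Sum>j\<in>{1..s m}. ga q m i j * theta N s al ga m (hd ts) j else 0)"
  by (cases ts rule: remdups_adj.cases) (simp_all add: distrib_right sum.distrib)

lemma theta_Node_other:
  "m \<noteq> q \<Longrightarrow> theta N s al ga q (Node m ts) i = 0"
  by (cases ts rule: remdups_adj.cases) simp_all

section \<open>The exact solution as a B-series\<close>

lemma bigo_at_right_antiderivative:
  fixes e e' :: "real \<Rightarrow> real"
  assumes T: "T > 0" and e0: "e 0 = 0"
    and der: "\<And>t. t \<in> {0..T} \<Longrightarrow> (e has_real_derivative e' t) (at t within {0..T})"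
    and e': "e' \<in> O[at_right 0](\<lambda>h. h ^ k)"
  shows "e \<in> O[at_right 0](\<lambda>h. h ^ Suc k)"
proof -
  obtain C where C: "C > 0" "\<forall>\<^sub>F h in at_right 0. norm (e' h) \<le> C * norm (h ^ k)"
    using e' by (elim landau_o.bigE)
  then obtain r where r: "r > 0" "\<And>h. 0 < h \<Longrightarrow> h < r \<Longrightarrow> \<bar>e' h\<bar> \<le> C * \<bar>h ^ k\<bar>"
    unfolding eventually_at_right_field by auto
  show ?thesis
  proof (rule bigoI[of _ C])
    have "\<bar>e h\<bar> \<le> C * \<bar>h ^ Suc k\<bar>" if h: "0 < h" "h < min r T" for h
    proof -
      have "(e has_derivative (*) (e' t)) (at t within {0..h})" if "0 \<le> t" "t \<le> h" for t
        using has_field_derivative_subset[OF der[of t], of "{0..h}"] that h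
        by (simp add: has_field_derivative_def)
      \<comment> \<open>The mean value theorem on [0, h] supplies the extra factor \<open>h\<close>;
        as \<xi> lies below \<open>h\<close>, the bound on \<open>e'\<close> at \<xi> passes to
        \<open>h\<close>.\<close>
      then obtain \<xi> where \<xi>: "\<xi> \<in> {0<..<h}" "e h - e 0 = e' \<xi> * (h - 0)"
        using mvt_simple[OF h(1), of e "\<lambda>t. (*) (e' t)"] by blast
      have "\<bar>e' \<xi>\<bar> \<le> C * \<xi> ^ k" using r(2)[of \<xi>] \<xi>(1) h by simp
      also have "\<dots> \<le> C * h ^ k" using \<xi>(1) C(1) by (intro mult_left_mono power_mono) auto
      finally have "\<bar>e' \<xi>\<bar> * h \<le> C * h ^ k * h" using h by (intro mult_right_mono) auto
      then show ?thesis using \<xi>(2) h e0 by (simp add: abs_mult algebra_simps)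
    qed
    then show "\<forall>\<^sub>F h in at_right 0. norm (e h) \<le> C * norm (h ^ Suc k)"
      unfolding eventually_at_right_field using r(1) T by (intro exI[of _ "min r T"]) auto
  qed
qed

text \<open>The numerator is \<open>rho (Node m ts)\<close>: differentiating
  \<open>h ^ rho u / dens u\<close> leaves the product of the reciprocal densities of the children,
  which is the recursion of the exact solution.\<close>

lemma rho_div_dens_Node:
  "(1 + real (sum_list (map rho ts))) / real (dens (Node m ts)) = prod_list (map (\<lambda>t. 1 / real (dens t)) ts)"
proof -
  have "prod_list (map (\<lambda>t. 1 / real (dens t)) ts) = 1 / real (prod_list (map dens ts))"
    by (induction ts) auto
  moreover have "(1 + real (sum_list (map rho ts))) \<noteq> 0" by (metis of_nat_Suc of_nat_neq_0)
  moreover have "real (dens (Node m ts)) = (1 + real (sum_list (map rho ts))) * real (prod_list (map dens ts))"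
    by (simp add: algebra_simps)
  ultimately show ?thesis
    by (metis divide_divide_eq_left divide_self)
qed

text \<open>Induction on the order: an expansion up to order \<open>n\<close>, put into the
  differential equation, gives the derivative to that order, and integration gains one. The base
  case is the one-sided differentiability at 0.\<close>

lemma exact_solution_bseries:
  assumes f: "\<And>m. m \<in> {1..N} \<Longrightarrow> smooth_field d (f m)" and T: "T > 0"
    and y: "is_solution N d f y0 T y" and c: "c < d"
  shows "(\<lambda>h. y h c - y0 c - bseries N d f y0 n (\<lambda>t. 1 / real (dens t)) h c)
     \<in> O[at_right 0](\<lambda>h. h ^ Suc n)"
  using c
proof (induction n arbitrary: c)
  case 0
  have "((\<lambda>t. y t c) has_real_derivative (\<Sum>m\<in>{1..N}. f m (y 0) c)) (at 0 within {0..T})"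
    using y T 0 unfolding is_solution_def by auto
  then have "((\<lambda>h. (y h c - y0 c) / h) \<longlongrightarrow> (\<Sum>m\<in>{1..N}. f m (y 0) c)) (at_right 0)"
    using y T by (simp add: has_field_derivative_iff at_within_Icc_at_right is_solution_def)
  then have "(\<lambda>h. y h c - y0 c) \<in> O[at_right 0](\<lambda>h. h)"
    by (rule bigoI_tendsto) (simp add: eventually_at_right_less eventually_at_filter)
  then show ?case by (simp add: bseries_0)
next
  case (Suc n)
  define A where "A = (\<lambda>t. 1 / real (dens t))"
  define Q where "Q m h = (\<Sum>ts\<in>forests N n. h ^ sum_list (map rho ts) *
     (prod_list (map A ts) * tweight (Node m ts)) * elem_diff d f y0 (Node m ts) c)" for m h
  have H: "((\<lambda>h::real. h) \<longlongrightarrow> 0) (at_right 0)" by (rule tendsto_ident_at)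
  have "(\<lambda>h. f m (\<lambda>c. y0 c + (y h c - y0 c)) c - Q m h) \<in> O[at_right 0](\<lambda>h. h ^ Suc n)"
    if "m \<in> {1..N}" for m
    unfolding Q_def
    by (rule smooth_field_bseries[where \<delta> = "\<lambda>h c. y h c - y0 c" and f = f and q = m, OF H f[OF that] Suc.prems])
      (use Suc.IH in \<open>simp add: A_def\<close>)
  then have e': "(\<lambda>h. \<Sum>m\<in>{1..N}. f m (y h) c - Q m h) \<in> O[at_right 0](\<lambda>h. h ^ Suc n)"
    by (intro big_sum_in_bigo) simp
  \<comment> \<open>Termwise differentiation cancels \<open>rho\<close> against \<open>dens\<close>,
    so the series of order \<open>Suc n\<close> has exactly the substituted series of order
    \<open>n\<close> as its derivative.\<close>
  have dB: "((\<lambda>h. bseries N d f y0 (Suc n) A h c) has_real_derivative (\<Sum>m\<in>{1..N}. Q m h))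
      (at h within {0..T})" for h
  proof -
    have term_deriv: "((\<lambda>h. h ^ rho (Node m ts) * (A (Node m ts) * tweight (Node m ts)) * elem_diff d f y0 (Node m ts) c)
        has_real_derivative h ^ sum_list (map rho ts) *
         (prod_list (map A ts) * tweight (Node m ts)) * elem_diff d f y0 (Node m ts) c) (at h within {0..T})" for m ts
    proof -
      have A_eq: "real (rho (Node m ts)) * A (Node m ts) = prod_list (map A ts)"
        using rho_div_dens_Node[of ts m] by (simp add: A_def del: dens.simps)
      have "((\<lambda>h. h ^ rho (Node m ts)) has_real_derivative
          real (rho (Node m ts)) * h ^ sum_list (map rho ts)) (at h within {0..T})"
        using DERIV_power[OF DERIV_ident, of "rho (Node m ts)" h "{0..T}"] by simp
      from DERIV_cmult_right[OF this, of "A (Node m ts) * tweight (Node m ts) * elem_diff d f y0 (Node m ts) c"]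
      show ?thesis unfolding A_eq[symmetric] by (simp only: mult_ac)
    qed
    show ?thesis
      unfolding bseries_def sum_trees_Suc Q_def by (intro DERIV_sum term_deriv)
  qed
  have "(\<lambda>h. y h c - y0 c - bseries N d f y0 (Suc n) A h c) \<in> O[at_right 0](\<lambda>h. h ^ Suc (Suc n))"
  proof (rule bigo_at_right_antiderivative[OF T _ _ e'])
    have "rho t \<noteq> 0" for t using rho_pos[of t] by simp
    then show "y 0 c - y0 c - bseries N d f y0 (Suc n) A 0 c = 0"
      using y by (simp add: bseries_def is_solution_def zero_power)
  next
    fix t assume t: "t \<in> {0..T}"
    have "((\<lambda>t. y t c) has_real_derivative (\<Sum>m\<in>{1..N}. f m (y t) c)) (at t within {0..T})"
      using y t Suc.prems unfolding is_solution_def by auto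
    from DERIV_diff[OF DERIV_diff[OF this DERIV_const] dB]
    show "((\<lambda>h. y h c - y0 c - bseries N d f y0 (Suc n) A h c) has_real_derivative
       (\<Sum>m\<in>{1..N}. f m (y t) c - Q m t)) (at t within {0..T})"
      by (simp add: sum_subtractf)
  qed
  then show ?case by (simp add: A_def)
qed

section \<open>Expansion of the stages\<close>

text \<open>The filter \<open>F\<close> allows the step size and the stages to vary together: no uniqueness of the
  solution of the stage equations is needed, and all constants are uniform in the stages.\<close>
locale gark_stages =
  fixes N :: nat and s :: "nat \<Rightarrow> nat" and al ga :: "nat \<Rightarrow> nat \<Rightarrow> nat \<Rightarrow> nat \<Rightarrow> real"
    and d :: nat and f :: "nat \<Rightarrow> (nat \<Rightarrow> real) \<Rightarrow> nat \<Rightarrow> real" and y0 :: "nat \<Rightarrow> real"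
    and F :: "'a filter" and H :: "'a \<Rightarrow> real" and K :: "'a \<Rightarrow> nat \<Rightarrow> nat \<Rightarrow> nat \<Rightarrow> real"
  assumes al_lower: "\<And>q m i j. q \<in> {1..N} \<Longrightarrow> m \<in> {1..N} \<Longrightarrow> i \<in> {1..s q} \<Longrightarrow> j \<in> {1..s m}
                        \<Longrightarrow> i \<le> j \<Longrightarrow> al q m i j = 0"
    and ga_lower: "\<And>q m i j. q \<in> {1..N} \<Longrightarrow> m \<in> {1..N} \<Longrightarrow> i \<in> {1..s q} \<Longrightarrow> j \<in> {1..s m}
                        \<Longrightarrow> i < j \<Longrightarrow> ga q m i j = 0"
    and smooth: "\<And>m. m \<in> {1..N} \<Longrightarrow> smooth_field d (f m)"
    and H: "(H \<longlongrightarrow> 0) F"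
    and stages: "\<forall>\<^sub>F x in F. stage_eqs N s al ga d f y0 (H x) (K x)"
begin

lemma stage_eq:
  assumes "q \<in> {1..N}" "i \<in> {1..s q}"
  shows "\<forall>\<^sub>F x in F. K x q i c =
    H x * (f q (\<lambda>c'. y0 c' + (\<Sum>m\<in>{1..N}. \<Sum>j\<in>{1..s m}. al q m i j * K x m j c')) c
      + jac d (f q) y0 (\<lambda>c'. \<Sum>m\<in>{1..N}. \<Sum>j\<in>{1..s m}. ga q m i j * K x m j c') c)"
  using stages
proof eventually_elim
  case (elim x)
  show ?case
    using fun_cong[OF elim[unfolded stage_eqs_def, rule_format, OF assms], of c]
    by (simp add: algebra_simps)
qed

text \<open>Strong induction on \<open>i\<close>, for all partitions together. The
  \<open>al\<close>-terms and the \<open>ga\<close>-terms with \<open>j < i\<close> are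
  \<open>O(H)\<close> by induction; the \<open>ga\<close>-terms with \<open>j = i\<close> couple the
  partitions, but their factor \<open>H\<close> lets them be absorbed.\<close>

lemma stages_bigo:
  assumes "q \<in> {1..N}" "i \<in> {1..s q}" "c < d"
  shows "(\<lambda>x. K x q i c) \<in> O[F](H)"
  using assms
proof (induction i arbitrary: q c rule: less_induct)
  case (less i)
  \<comment> \<open>Collects the \<open>i\<close>-th stages of all partitions that have one, since
    the diagonal \<open>ga\<close>-terms only allow a joint bound.\<close>
  define S where "S x = (\<Sum>m\<in>{1..N}. \<Sum>c<d. if i \<in> {1..s m} then \<bar>K x m i c\<bar> else 0)" for x
  have S_nonneg: "0 \<le> S x" for x unfolding S_def by (intro sum_nonneg) auto
  have K_le_S: "\<bar>K x m i c\<bar> \<le> S x" if "m \<in> {1..N}" "i \<in> {1..s m}" "c < d" for x m c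
  proof -
    have "\<bar>K x m i c\<bar> \<le> (\<Sum>c<d. if i \<in> {1..s m} then \<bar>K x m i c\<bar> else 0)"
      using member_le_sum[of c "{..<d}" "\<lambda>c. if i \<in> {1..s m} then \<bar>K x m i c\<bar> else 0"] that by simp
    also have "\<dots> \<le> S x" unfolding S_def
      using that by (intro member_le_sum[of m "{1..N}" "\<lambda>m. \<Sum>c<d. if i \<in> {1..s m} then \<bar>K x m i c\<bar> else 0"])
        (auto intro!: sum_nonneg)
    finally show ?thesis .
  qed
  have bound: "\<exists>r B. r \<in> O[F](H) \<and> (\<forall>\<^sub>F x in F. \<bar>K x q i c\<bar> \<le> \<bar>r x\<bar> + \<bar>H x\<bar> * B * S x)"
    if q: "q \<in> {1..N}" and i: "i \<in> {1..s q}" and c: "c < d" for q c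
  proof -
    define D where "D l = deriv (\<lambda>t. f q (y0(l := t)) c) (y0 l)" for l
    define \<delta> where "\<delta> x c' = (\<Sum>m\<in>{1..N}. \<Sum>j\<in>{1..s m}. al q m i j * K x m j c')" for x c'
    define Lo where "Lo x l = (\<Sum>m\<in>{1..N}. \<Sum>j\<in>{1..s m}. if j < i then ga q m i j * K x m j l else 0)" for x l
    define Hi where "Hi x l = (\<Sum>m\<in>{1..N}. \<Sum>j\<in>{1..s m}. if j = i then ga q m i j * K x m j l else 0)" for x l
    define B where "B = (\<Sum>l<d. \<bar>D l\<bar> * (\<Sum>m\<in>{1..N}. \<Sum>j\<in>{1..s m}. \<bar>ga q m i j\<bar>))"
    define r where "r x = H x * (f q (\<lambda>c'. y0 c' + \<delta> x c') c + (\<Sum>l<d. D l * Lo x l))" for x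
    have H1: "H \<in> O[F](\<lambda>_. 1)" using bigo_power_mono[OF H, of 0 1] by simp
    have low: "(\<lambda>x. K x m j l) \<in> O[F](H)" if "m \<in> {1..N}" "j \<in> {1..s m}" "j < i" "l < d" for m j l
      using less.IH that by blast
    have "(\<lambda>x. \<delta> x c') \<in> O[F](H)" if "c' < d" for c'
      unfolding \<delta>_def
    proof (intro big_sum_in_bigo)
      fix m j assume mj: "m \<in> {1..N}" "j \<in> {1..s m}"
      show "(\<lambda>x. al q m i j * K x m j c') \<in> O[F](H)"
        using low[OF mj _ that] al_lower[OF q mj(1) i mj(2)] by (cases "j < i") auto
    qed
    \<comment> \<open>The expansion of order zero: only the empty forest is left, so
      \<open>f q\<close> at the stage argument is \<open>f q y0\<close> up to
      \<open>O(H)\<close>.\<close>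
    then have "(\<lambda>x. f q (\<lambda>c'. y0 c' + \<delta> x c') c -
      (\<Sum>ts\<in>forests N 0. H x ^ sum_list (map rho ts) *
         (prod_list (map (\<lambda>_. 0) ts) * tweight (Node q ts)) * elem_diff d f y0 (Node q ts) c)) \<in> O[F](\<lambda>x. H x ^ Suc 0)"
      by (intro smooth_field_bseries[where f = f and q = q, OF H smooth[OF q] c]) (simp add: bseries_0)
    moreover have "forests N 0 = {[]}" using forests_subset[of N 0] by (auto simp: forests_def)
    ultimately have "(\<lambda>x. f q (\<lambda>c'. y0 c' + \<delta> x c') c - f q y0 c) \<in> O[F](H)"
      by simp
    from sum_in_bigo(1)[OF landau_o.big_trans[OF this H1] bigo_const[of "f q y0 c"]]
    have f1: "(\<lambda>x. f q (\<lambda>c'. y0 c' + \<delta> x c') c) \<in> O[F](\<lambda>_. 1)" by simp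
    have "(\<lambda>x. Lo x l) \<in> O[F](H)" if "l < d" for l
      unfolding Lo_def
    proof (intro big_sum_in_bigo)
      fix m j assume mj: "m \<in> {1..N}" "j \<in> {1..s m}"
      show "(\<lambda>x. if j < i then ga q m i j * K x m j l else 0) \<in> O[F](H)"
        using low[OF mj _ that] by (cases "j < i") auto
    qed
    then have "(\<lambda>x. \<Sum>l<d. D l * Lo x l) \<in> O[F](H)"
      by (intro big_sum_in_bigo) auto
    from landau_o.big.mult[OF landau_o.big_refl[of H F]
        sum_in_bigo(1)[OF f1 landau_o.big_trans[OF this H1]]]
    have r: "r \<in> O[F](H)" by (simp add: r_def[abs_def])
    have Hi_le: "\<bar>\<Sum>l<d. D l * Hi x l\<bar> \<le> B * S x" for x
    proof -
      have "\<bar>Hi x l\<bar> \<le> (\<Sum>m\<in>{1..N}. \<Sum>j\<in>{1..s m}. \<bar>ga q m i j\<bar>) * S x" if "l < d" for l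
      proof -
        have "\<bar>Hi x l\<bar> \<le> (\<Sum>m\<in>{1..N}. \<Sum>j\<in>{1..s m}. \<bar>if j = i then ga q m i j * K x m j l else 0\<bar>)"
          unfolding Hi_def by (intro order_trans[OF sum_abs] sum_mono) simp
        also have "\<dots> \<le> (\<Sum>m\<in>{1..N}. \<Sum>j\<in>{1..s m}. \<bar>ga q m i j\<bar> * S x)"
        proof (intro sum_mono)
          fix m j assume mj: "m \<in> {1..N}" "j \<in> {1..s m}"
          show "\<bar>if j = i then ga q m i j * K x m j l else 0\<bar> \<le> \<bar>ga q m i j\<bar> * S x"
            using mult_left_mono[OF K_le_S[of m l x], of "\<bar>ga q m i j\<bar>"] mj that S_nonneg[of x]
            by (cases "j = i") (simp_all add: abs_mult)
        qed
        finally show ?thesis by (simp add: sum_distrib_right)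
      qed
      then have "\<bar>\<Sum>l<d. D l * Hi x l\<bar> \<le> (\<Sum>l<d. \<bar>D l\<bar> * ((\<Sum>m\<in>{1..N}. \<Sum>j\<in>{1..s m}. \<bar>ga q m i j\<bar>) * S x))"
        by (intro order_trans[OF sum_abs] sum_mono) (auto simp: abs_mult mult_left_mono)
      then show ?thesis by (simp add: B_def sum_distrib_right mult.assoc)
    qed
    have "\<forall>\<^sub>F x in F. \<bar>K x q i c\<bar> \<le> \<bar>r x\<bar> + \<bar>H x\<bar> * B * S x"
      using stage_eq[OF q i, of c]
    proof eventually_elim
      case (elim x)
      have split: "(\<Sum>m\<in>{1..N}. \<Sum>j\<in>{1..s m}. ga q m i j * K x m j l) = Lo x l + Hi x l" for l
        unfolding Lo_def Hi_def sum.distrib[symmetric]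
      proof (intro sum.cong refl)
        fix m j assume mj: "m \<in> {1..N}" "j \<in> {1..s m}"
        show "ga q m i j * K x m j l = (if j < i then ga q m i j * K x m j l else 0)
            + (if j = i then ga q m i j * K x m j l else 0)"
          using ga_lower[OF q mj(1) i mj(2)] by (cases j i rule: linorder_cases) auto
      qed
      have "K x q i c = r x + H x * (\<Sum>l<d. D l * Hi x l)"
        using elim unfolding r_def jac_def split \<delta>_def[symmetric] D_def[symmetric]
        by (simp add: algebra_simps sum.distrib)
      then have "\<bar>K x q i c\<bar> \<le> \<bar>r x\<bar> + \<bar>H x\<bar> * \<bar>\<Sum>l<d. D l * Hi x l\<bar>"
        by (simp flip: abs_mult)
      also have "\<dots> \<le> \<bar>r x\<bar> + \<bar>H x\<bar> * (B * S x)"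
        using Hi_le by (intro add_left_mono mult_left_mono) auto
      finally show ?case by (simp add: mult.assoc)
    qed
    then show ?thesis using r by blast
  qed
  define I where "I = {m\<in>{1..N}. i \<in> {1..s m}} \<times> {..<d}"
  have finI: "finite I" by (simp add: I_def)
  have S_eq: "S x = (\<Sum>(m, c)\<in>I. \<bar>K x m i c\<bar>)" for x
  proof -
    have "S x = (\<Sum>m\<in>{1..N}. if i \<in> {1..s m} then (\<Sum>c<d. \<bar>K x m i c\<bar>) else 0)"
      unfolding S_def by (intro sum.cong) auto
    also have "\<dots> = (\<Sum>m | m \<in> {1..N} \<and> i \<in> {1..s m}. \<Sum>c<d. \<bar>K x m i c\<bar>)"
      by (rule sum.inter_filter[symmetric]) simp
    finally show ?thesis by (simp add: I_def sum.cartesian_product)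
  qed
  have "\<forall>z\<in>I. \<exists>rB. fst rB \<in> O[F](H) \<and> (\<forall>\<^sub>F x in F. \<bar>K x (fst z) i (snd z)\<bar> \<le> \<bar>fst rB x\<bar> + \<bar>H x\<bar> * snd rB * S x)"
  proof
    fix z assume "z \<in> I"
    then obtain r B where "r \<in> O[F](H)"
      "\<forall>\<^sub>F x in F. \<bar>K x (fst z) i (snd z)\<bar> \<le> \<bar>r x\<bar> + \<bar>H x\<bar> * B * S x"
      using bound[of "fst z" "snd z"] unfolding I_def by (elim SigmaE) auto
    then show "\<exists>rB. fst rB \<in> O[F](H) \<and>
        (\<forall>\<^sub>F x in F. \<bar>K x (fst z) i (snd z)\<bar> \<le> \<bar>fst rB x\<bar> + \<bar>H x\<bar> * snd rB * S x)"
      by (intro exI[of _ "(r, B)"]) simp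
  qed
  from bchoice[OF this] obtain rB where rB': "\<forall>z\<in>I. fst (rB z) \<in> O[F](H) \<and>
      (\<forall>\<^sub>F x in F. \<bar>K x (fst z) i (snd z)\<bar> \<le> \<bar>fst (rB z) x\<bar> + \<bar>H x\<bar> * snd (rB z) * S x)"
    by blast
  define r where "r z = fst (rB z)" for z
  define B where "B z = snd (rB z)" for z
  have rB: "r z \<in> O[F](H)"
    "\<forall>\<^sub>F x in F. \<bar>K x (fst z) i (snd z)\<bar> \<le> \<bar>r z x\<bar> + \<bar>H x\<bar> * B z * S x" if "z \<in> I" for z
    using rB' that by (simp_all add: r_def B_def)
  define R where "R x = (\<Sum>z\<in>I. \<bar>r z x\<bar>)" for x
  have R: "R \<in> O[F](H)" unfolding R_def[abs_def] using rB(1) by (intro big_sum_in_bigo) auto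
  \<comment> \<open>For small \<open>H\<close> the added bounds give
    \<open>S \<le> R + S / 2\<close>, hence \<open>S \<le> 2 * R\<close>.\<close>
  have "((\<lambda>x. \<bar>H x\<bar> * (\<Sum>z\<in>I. B z)) \<longlongrightarrow> \<bar>0\<bar> * (\<Sum>z\<in>I. B z)) F"
    by (intro tendsto_intros H)
  then have "\<forall>\<^sub>F x in F. \<bar>H x\<bar> * (\<Sum>z\<in>I. B z) < 1 / 2"
    by (rule order_tendstoD) simp
  moreover have "\<forall>\<^sub>F x in F. \<forall>z\<in>I. \<bar>K x (fst z) i (snd z)\<bar> \<le> \<bar>r z x\<bar> + \<bar>H x\<bar> * B z * S x"
    using rB(2) finI by (intro eventually_ball_finite) auto
  ultimately have "\<forall>\<^sub>F x in F. norm (K x q i c) \<le> 2 * norm (R x)"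
  proof eventually_elim
    case (elim x)
    have "S x = (\<Sum>z\<in>I. \<bar>K x (fst z) i (snd z)\<bar>)"
      by (simp add: S_eq case_prod_unfold)
    also have "\<dots> \<le> (\<Sum>z\<in>I. \<bar>r z x\<bar> + \<bar>H x\<bar> * B z * S x)"
      using elim(2) by (intro sum_mono) blast
    also have "\<dots> = R x + \<bar>H x\<bar> * (\<Sum>z\<in>I. B z) * S x"
      by (simp only: R_def sum.distrib sum_distrib_left sum_distrib_right)
    also have "\<dots> \<le> R x + 1 / 2 * S x"
      using elim(1) S_nonneg[of x] by (intro add_left_mono mult_right_mono) auto
    finally have "S x \<le> 2 * R x" by simp
    moreover have "0 \<le> R x" unfolding R_def by (intro sum_nonneg) auto
    ultimately show ?case using K_le_S[OF less.prems, of x] by simp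
  qed
  then have "(\<lambda>x. K x q i c) \<in> O[F](R)" by (rule bigoI)
  then show ?case using R by (rule landau_o.big_trans)
qed

text \<open>Induction on \<open>n\<close>, where the factor \<open>H\<close> of the stage equation
  raises the order. The field yields the \<open>al\<close>-products over all forests; the Jacobian,
  being linear, yields single children only. Their sum is the recursion of
  \<open>theta\<close>.\<close>

lemma stages_bseries:
  assumes "q \<in> {1..N}" "i \<in> {1..s q}" "c < d"
  shows "(\<lambda>x. K x q i c - bseries N d f y0 n (\<lambda>t. theta N s al ga q t i) (H x) c)
    \<in> O[F](\<lambda>x. H x ^ Suc n)"
  using assms
proof (induction n arbitrary: q i c)
  case 0
  then show ?case using stages_bigo by (simp add: bseries_0)
next
  case (Suc n)
  note q = \<open>q \<in> {1..N}\<close> and i = \<open>i \<in> {1..s q}\<close> and c = \<open>c < d\<close>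
  \<comment> \<open>Expansions pass to linear combinations of stages; \<open>co\<close> stands for a
    row of \<open>al\<close> or of \<open>ga\<close>.\<close>
  have lin: "(\<lambda>x. (\<Sum>m\<in>{1..N}. \<Sum>j\<in>{1..s m}. co m j * K x m j l) -
      bseries N d f y0 n (\<lambda>t. \<Sum>m\<in>{1..N}. \<Sum>j\<in>{1..s m}. co m j * theta N s al ga m t j) (H x) l)
      \<in> O[F](\<lambda>x. H x ^ Suc n)" if "l < d" for co l
  proof -
    have "(\<lambda>x. \<Sum>m\<in>{1..N}. \<Sum>j\<in>{1..s m}. co m j *
        (K x m j l - bseries N d f y0 n (\<lambda>t. theta N s al ga m t j) (H x) l)) \<in> O[F](\<lambda>x. H x ^ Suc n)"
      by (intro big_sum_in_bigo) (use Suc.IH that in simp)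
    then show ?thesis
      by (simp add: bseries_sum bseries_scale right_diff_distrib sum_subtractf)
  qed
  define a where "a t = (\<Sum>m\<in>{1..N}. \<Sum>j\<in>{1..s m}. al q m i j * theta N s al ga m t j)" for t
  define g where "g t = (\<Sum>m\<in>{1..N}. \<Sum>j\<in>{1..s m}. ga q m i j * theta N s al ga m t j)" for t
  \<comment> \<open>The \<open>ga\<close>-part of \<open>theta\<close>, extended by 0 to all forests
    so that it can be added to the \<open>al\<close>-part forest by forest.\<close>
  define g1 where "g1 ts = (if length ts = 1 then g (hd ts) else 0)" for ts
  define E where "E ts = tweight (Node q ts) * elem_diff d f y0 (Node q ts) c" for ts
  define D where "D l = deriv (\<lambda>t. f q (y0(l := t)) c) (y0 l)" for l
  have theta: "theta N s al ga q (Node q ts) i = prod_list (map a ts) + g1 ts" for ts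
    by (simp add: theta_Node a_def[abs_def] g_def g1_def)
  have X1: "(\<lambda>x. f q (\<lambda>c'. y0 c' + (\<Sum>m\<in>{1..N}. \<Sum>j\<in>{1..s m}. al q m i j * K x m j c')) c -
      (\<Sum>ts\<in>forests N n. H x ^ sum_list (map rho ts) * (prod_list (map a ts) * E ts)))
      \<in> O[F](\<lambda>x. H x ^ Suc n)"
    using smooth_field_bseries[where A = a and f = f and q = q, OF H smooth[OF q] c, OF lin[of _ "\<lambda>m. al q m i", folded a_def]]
    by (simp add: E_def mult.assoc del: tweight.simps elem_diff.simps)
  have "(\<lambda>x. \<Sum>l<d. D l * ((\<Sum>m\<in>{1..N}. \<Sum>j\<in>{1..s m}. ga q m i j * K x m j l)
       - bseries N d f y0 n g (H x) l)) \<in> O[F](\<lambda>x. H x ^ Suc n)"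
    unfolding g_def by (intro big_sum_in_bigo) (use lin in simp)
  moreover have "(\<Sum>l<d. D l * bseries N d f y0 n g h l)
      = (\<Sum>ts\<in>forests N n. h ^ sum_list (map rho ts) * (g1 ts * E ts))" for h
  proof -
    have "(\<lambda>t. [t]) ` trees N n = {ts\<in>forests N n. length ts = 1}"
      by (auto simp: trees_def forests_def length_Suc_conv)
    moreover have "inj_on (\<lambda>t. [t]) (trees N n)" by (simp add: inj_on_def)
    ultimately have "(\<Sum>ts | ts \<in> forests N n \<and> length ts = 1. h ^ sum_list (map rho ts) * (g1 ts * E ts))
        = (\<Sum>t\<in>trees N n. h ^ rho t * (g t * E [t]))"
      using sum.reindex[of "\<lambda>t. [t]" "trees N n" "\<lambda>ts. h ^ sum_list (map rho ts) * (g1 ts * E ts)"]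
      by (simp add: g1_def)
    moreover have "(\<Sum>ts | ts \<in> forests N n \<and> length ts = 1. h ^ sum_list (map rho ts) * (g1 ts * E ts))
        = (\<Sum>ts\<in>forests N n. h ^ sum_list (map rho ts) * (g1 ts * E ts))"
      by (intro sum.mono_neutral_left finite_forests) (auto simp: g1_def)
    moreover have "(\<Sum>t\<in>trees N n. h ^ rho t * (g t * E [t])) = (\<Sum>l<d. D l * bseries N d f y0 n g h l)"
    proof -
      \<comment> \<open>Contracting the Jacobian with the elementary differential of
        \<open>t\<close> gives that of \<open>Node q [t]\<close>; the weight is unchanged because
        \<open>fact 1 = 1\<close>.\<close>
      have "E [t] = (\<Sum>l<d. D l * (tweight t * elem_diff d f y0 t l))" for t
        by (simp add: E_def D_def sum_distrib_left algebra_simps)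
      then have "(\<Sum>t\<in>trees N n. h ^ rho t * (g t * E [t])) =
         (\<Sum>t\<in>trees N n. \<Sum>l<d. D l * (h ^ rho t * (g t * tweight t) * elem_diff d f y0 t l))"
        by (simp add: sum_distrib_left algebra_simps)
      also have "\<dots> = (\<Sum>l<d. D l * bseries N d f y0 n g h l)"
        by (subst sum.swap) (simp add: bseries_def sum_distrib_left)
      finally show ?thesis .
    qed
    ultimately show ?thesis by simp
  qed
  ultimately have X2: "(\<lambda>x. jac d (f q) y0 (\<lambda>c'. \<Sum>m\<in>{1..N}. \<Sum>j\<in>{1..s m}. ga q m i j * K x m j c') c -
      (\<Sum>ts\<in>forests N n. H x ^ sum_list (map rho ts) * (g1 ts * E ts))) \<in> O[F](\<lambda>x. H x ^ Suc n)"
    by (simp add: jac_def D_def[symmetric] right_diff_distrib sum_subtractf)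
  have B: "bseries N d f y0 (Suc n) (\<lambda>t. theta N s al ga q t i) h c
     = h * ((\<Sum>ts\<in>forests N n. h ^ sum_list (map rho ts) * (prod_list (map a ts) * E ts)) +
        (\<Sum>ts\<in>forests N n. h ^ sum_list (map rho ts) * (g1 ts * E ts)))" for h
  proof -
    have "bseries N d f y0 (Suc n) (\<lambda>t. theta N s al ga q t i) h c =
      (\<Sum>m\<in>{1..N}. if m = q then \<Sum>ts\<in>forests N n. h ^ rho (Node q ts) *
        (theta N s al ga q (Node q ts) i * tweight (Node q ts)) * elem_diff d f y0 (Node q ts) c else 0)"
      unfolding bseries_def sum_trees_Suc by (intro sum.cong refl) (simp add: theta_Node_other)
    also have "\<dots> = (\<Sum>ts\<in>forests N n. h * (h ^ sum_list (map rho ts) * ((prod_list (map a ts) + g1 ts) * E ts)))"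
      using q by (simp add: theta E_def mult.assoc del: tweight.simps elem_diff.simps)
    finally show ?thesis
      by (simp add: sum.distrib sum_distrib_left algebra_simps)
  qed
  have "(\<lambda>x. H x * (f q (\<lambda>c'. y0 c' + (\<Sum>m\<in>{1..N}. \<Sum>j\<in>{1..s m}. al q m i j * K x m j c')) c
      + jac d (f q) y0 (\<lambda>c'. \<Sum>m\<in>{1..N}. \<Sum>j\<in>{1..s m}. ga q m i j * K x m j c') c)
     - bseries N d f y0 (Suc n) (\<lambda>t. theta N s al ga q t i) (H x) c) \<in> O[F](\<lambda>x. H x ^ Suc (Suc n))"
    using landau_o.big.mult[OF landau_o.big_refl[of H F] sum_in_bigo(1)[OF X1 X2]]
    unfolding B by (simp add: algebra_simps)
  moreover have "\<forall>\<^sub>F x in F. H x * (f q (\<lambda>c'. y0 c' + (\<Sum>m\<in>{1..N}. \<Sum>j\<in>{1..s m}. al q m i j * K x m j c')) c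
      + jac d (f q) y0 (\<lambda>c'. \<Sum>m\<in>{1..N}. \<Sum>j\<in>{1..s m}. ga q m i j * K x m j c') c)
     - bseries N d f y0 (Suc n) (\<lambda>t. theta N s al ga q t i) (H x) c =
     K x q i c - bseries N d f y0 (Suc n) (\<lambda>t. theta N s al ga q t i) (H x) c"
    using stage_eq[OF q i, of c] by eventually_elim simp
  ultimately show ?case by (rule landau_o.big.in_cong[THEN iffD1, rotated])
qed

end

section \<open>Sufficiency of the order conditions\<close>

theorem order_conditions_sufficient:
  assumes al_lower: "\<And>q m i j. q \<in> {1..N} \<Longrightarrow> m \<in> {1..N} \<Longrightarrow> i \<in> {1..s q} \<Longrightarrow> j \<in> {1..s m}
                        \<Longrightarrow> i \<le> j \<Longrightarrow> al q m i j = 0"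
    and ga_lower: "\<And>q m i j. q \<in> {1..N} \<Longrightarrow> m \<in> {1..N} \<Longrightarrow> i \<in> {1..s q} \<Longrightarrow> j \<in> {1..s m}
                        \<Longrightarrow> i < j \<Longrightarrow> ga q m i j = 0"
    and cond: "\<And>t. colors_ok N t \<Longrightarrow> rho t \<le> p \<Longrightarrow>
        (\<Sum>m\<in>{1..N}. \<Sum>i\<in>{1..s m}. b m i * theta N s al ga m t i) = 1 / real (dens t)"
  shows "gark_ros_order N s b al ga p"
  unfolding gark_ros_order_def
proof (intro allI impI)
  fix d f y0 T y
  assume smooth: "\<forall>m\<in>{1..N}. smooth_field d (f m)" and T: "(0::real) < T"
    and y: "is_solution N d f y0 T y"
  \<comment> \<open>Step sizes tending to 0 from the right, each paired with any solution of its
    stage equations. What holds eventually holds for all small \<open>h\<close> and all such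
    \<open>k\<close>, as the definition of order demands.\<close>
  define F :: "(real \<times> (nat \<Rightarrow> nat \<Rightarrow> nat \<Rightarrow> real)) filter" where
    "F = inf (filtercomap fst (at_right 0)) (principal {(h, k). stage_eqs N s al ga d f y0 h k})"
  have fst_F: "filterlim fst (at_right 0) F"
    unfolding F_def by (rule filterlim_mono[OF filterlim_filtercomap order_refl inf_le1])
  have st: "\<forall>\<^sub>F x in F. stage_eqs N s al ga d f y0 (fst x) (snd x)"
    unfolding F_def eventually_inf_principal by (intro always_eventually) auto
  interpret gark_stages N s al ga d f y0 F fst snd
  proof
    show "(fst \<longlongrightarrow> 0) F"
      using at_within_le_nhds by (rule filterlim_mono[OF fst_F _ order_refl])
  qed (use al_lower ga_lower smooth st in auto)
  define W where "W t = (\<Sum>m\<in>{1..N}. \<Sum>i\<in>{1..s m}. b m i * theta N s al ga m t i)" for t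
  have err: "(\<lambda>x. step_result N s b y0 (snd x) c - y (fst x) c) \<in> O[F](\<lambda>x. fst x ^ Suc p)"
    if c: "c < d" for c
  proof -
    have "(\<lambda>x. \<Sum>m\<in>{1..N}. \<Sum>i\<in>{1..s m}. b m i *
        (snd x m i c - bseries N d f y0 p (\<lambda>t. theta N s al ga m t i) (fst x) c)) \<in> O[F](\<lambda>x. fst x ^ Suc p)"
      by (intro big_sum_in_bigo) (use stages_bseries c in simp)
    then have 1: "(\<lambda>x. step_result N s b y0 (snd x) c - y0 c - bseries N d f y0 p W (fst x) c)
        \<in> O[F](\<lambda>x. fst x ^ Suc p)"
      by (simp add: W_def[abs_def] step_result_def bseries_sum bseries_scale right_diff_distrib sum_subtractf)
    have 2: "(\<lambda>x. y (fst x) c - y0 c - bseries N d f y0 p (\<lambda>t. 1 / real (dens t)) (fst x) c)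
        \<in> O[F](\<lambda>x. fst x ^ Suc p)"
      using landau_o.big.compose[OF exact_solution_bseries[OF _ T y c] fst_F] smooth by blast
    \<comment> \<open>The order conditions equate the coefficients of all trees with at most
      \<open>p\<close> vertices, so both truncated series coincide and only the errors
      remain.\<close>
    have "bseries N d f y0 p W h c = bseries N d f y0 p (\<lambda>t. 1 / real (dens t)) h c" for h
      unfolding bseries_def W_def by (intro sum.cong refl) (simp only: trees_def mem_Collect_eq cond)
    then show ?thesis using sum_in_bigo(2)[OF 1 2] by simp
  qed
  have "\<forall>c\<in>{..<d}. \<exists>C>0. \<forall>\<^sub>F x in F. \<bar>step_result N s b y0 (snd x) c - y (fst x) c\<bar> \<le> C * \<bar>fst x ^ Suc p\<bar>"
  proof
    fix c assume "c \<in> {..<d}"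
    then obtain C where "C > 0"
        "\<forall>\<^sub>F x in F. norm (step_result N s b y0 (snd x) c - y (fst x) c) \<le> C * norm (fst x ^ Suc p)"
      using err[of c] by (auto elim: landau_o.bigE)
    then show "\<exists>C>0. \<forall>\<^sub>F x in F. \<bar>step_result N s b y0 (snd x) c - y (fst x) c\<bar> \<le> C * \<bar>fst x ^ Suc p\<bar>"
      by auto
  qed
  from bchoice[OF this] obtain C where "\<forall>c\<in>{..<d}. C c > 0 \<and>
      (\<forall>\<^sub>F x in F. \<bar>step_result N s b y0 (snd x) c - y (fst x) c\<bar> \<le> C c * \<bar>fst x ^ Suc p\<bar>)"
    by (rule exE)
  then have C: "C c > 0"
      "\<forall>\<^sub>F x in F. \<bar>step_result N s b y0 (snd x) c - y (fst x) c\<bar> \<le> C c * \<bar>fst x ^ Suc p\<bar>" if "c < d" for c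
    using that by simp_all
  have "\<forall>\<^sub>F x in F. \<forall>c\<in>{..<d}. \<bar>step_result N s b y0 (snd x) c - y (fst x) c\<bar> \<le> C c * \<bar>fst x ^ Suc p\<bar>"
    using C(2) by (intro eventually_ball_finite) auto
  then obtain P where P: "eventually P (at_right 0)"
    "\<forall>x. P (fst x) \<longrightarrow> x \<in> {(h, k). stage_eqs N s al ga d f y0 h k} \<longrightarrow>
      (\<forall>c\<in>{..<d}. \<bar>step_result N s b y0 (snd x) c - y (fst x) c\<bar> \<le> C c * \<bar>fst x ^ Suc p\<bar>)"
    unfolding F_def eventually_inf_principal eventually_filtercomap by (elim exE conjE)
  obtain r where r0: "r > 0" "\<And>h. 0 < h \<Longrightarrow> h < r \<Longrightarrow> P h"
    using P(1) unfolding eventually_at_right_field by blast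
  have r: "\<bar>step_result N s b y0 k c - y h c\<bar> \<le> C c * \<bar>h ^ Suc p\<bar>"
    if "0 < h" "h < r" "stage_eqs N s al ga d f y0 h k" "c < d" for h k c
    using P(2)[rule_format, of "(h, k)" c] r0(2)[of h] that by simp
  have "\<bar>step_result N s b y0 k c - y h c\<bar> \<le> (\<Sum>c<d. C c) * h ^ (p + 1)"
    if h: "0 < h" "h < r" and k: "stage_eqs N s al ga d f y0 h k" and c: "c < d" for h k c
  proof -
    have "\<bar>step_result N s b y0 k c - y h c\<bar> \<le> C c * h ^ (p + 1)"
      using r[OF h k c] h by simp
    also have "\<dots> \<le> (\<Sum>c<d. C c) * h ^ (p + 1)"
      using h c C(1) by (intro mult_right_mono member_le_sum) (auto intro: less_imp_le)
    finally show ?thesis .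
  qed
  then show "\<exists>C del. del > 0 \<and> (\<forall>h k. 0 < h \<and> h < del \<longrightarrow> stage_eqs N s al ga d f y0 h k \<longrightarrow>
      (\<forall>c<d. \<bar>step_result N s b y0 k c - y h c\<bar> \<le> C * h ^ (p + 1)))"
    using r0(1) by blast
qed

section \<open>Necessity\<close>

inductive poly_fun :: "nat \<Rightarrow> ((nat \<Rightarrow> real) \<Rightarrow> real) \<Rightarrow> bool" for d where
  poly_const: "poly_fun d (\<lambda>_. a)"
| poly_coord: "j < d \<Longrightarrow> poly_fun d (\<lambda>x. x j)"
| poly_add: "poly_fun d g \<Longrightarrow> poly_fun d g' \<Longrightarrow> poly_fun d (\<lambda>x. g x + g' x)"
| poly_mult: "poly_fun d g \<Longrightarrow> poly_fun d g' \<Longrightarrow> poly_fun d (\<lambda>x. g x * g' x)"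

text \<open>A partial derivative of a polynomial is again a polynomial; iterating this yields
  \<open>smooth_fun\<close> at all orders at once.\<close>

lemma poly_fun_partial:
  assumes "poly_fun d g"
  shows "\<exists>D. poly_fun d D \<and> (\<forall>x t. ((\<lambda>t. g (x(j := t))) has_real_derivative D (x(j := t))) (at t))"
  using assms
proof induction
  case (poly_const a)
  then show ?case by (intro exI[of _ "\<lambda>_. 0"]) (auto intro: poly_fun.poly_const)
next
  case (poly_coord i)
  then show ?case
    by (intro exI[of _ "\<lambda>_. if i = j then 1 else 0"]) (auto intro: poly_fun.poly_const)
next
  case (poly_add g g')
  then obtain D D' where "poly_fun d D" "\<And>x t. ((\<lambda>t. g (x(j := t))) has_real_derivative D (x(j := t))) (at t)"
    "poly_fun d D'" "\<And>x t. ((\<lambda>t. g' (x(j := t))) has_real_derivative D' (x(j := t))) (at t)"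
    by blast
  then show ?case
    by (intro exI[of _ "\<lambda>x. D x + D' x"] conjI allI poly_fun.poly_add DERIV_add)
next
  case (poly_mult g g')
  then obtain D D' where "poly_fun d D" "\<And>x t. ((\<lambda>t. g (x(j := t))) has_real_derivative D (x(j := t))) (at t)"
    "poly_fun d D'" "\<And>x t. ((\<lambda>t. g' (x(j := t))) has_real_derivative D' (x(j := t))) (at t)"
    by blast
  then show ?case using poly_mult.hyps
    by (intro exI[of _ "\<lambda>x. D x * g' x + D' x * g x"] conjI allI
        poly_fun.poly_add poly_fun.poly_mult DERIV_mult)
qed

lemma poly_fun_coord_dep: "poly_fun d g \<Longrightarrow> coord_dep d g"
proof (induction rule: poly_fun.induct)
  case (poly_add g g')
  then show ?case unfolding coord_dep_def by metis
next
  case (poly_mult g g')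
  then show ?case unfolding coord_dep_def by metis
qed (auto simp: coord_dep_def)

text \<open>Covers sum and product together: the pair \<open>(g x, g' x)\<close> varies continuously
  in the plane, where \<open>bop\<close> is continuous.\<close>

lemma coord_cont_combine:
  assumes g: "coord_cont d g" and g': "coord_cont d g'"
    and op: "\<And>a b. isCont (\<lambda>z. bop (fst z) (snd z)) (a, b)"
  shows "coord_cont d (\<lambda>x. bop (g x) (g' x) :: real)"
  unfolding coord_cont_def
proof (intro allI impI)
  fix x and e :: real assume "e > 0"
  then obtain \<eta> where \<eta>: "\<eta> > 0" "\<And>z. dist z (g x, g' x) < \<eta> \<Longrightarrow> dist (bop (fst z) (snd z)) (bop (g x) (g' x)) < e"
    using op[of "g x" "g' x"] unfolding continuous_at_eps_delta by fastforce
  have \<eta>2: "\<eta> / 2 > 0" using \<eta> by simp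
  obtain r where r: "r > 0" "\<And>x'. (\<forall>c<d. \<bar>x' c - x c\<bar> < r) \<Longrightarrow> \<bar>g x' - g x\<bar> < \<eta> / 2"
    using g[unfolded coord_cont_def, rule_format, OF \<eta>2, of x] by blast
  obtain r' where r': "r' > 0" "\<And>x'. (\<forall>c<d. \<bar>x' c - x c\<bar> < r') \<Longrightarrow> \<bar>g' x' - g' x\<bar> < \<eta> / 2"
    using g'[unfolded coord_cont_def, rule_format, OF \<eta>2, of x] by blast
  show "\<exists>del>0. \<forall>x'. (\<forall>c<d. \<bar>x' c - x c\<bar> < del) \<longrightarrow> \<bar>bop (g x') (g' x') - bop (g x) (g' x)\<bar> < e"
  proof (intro exI[of _ "min r r'"] conjI allI impI)
    fix x' assume "\<forall>c<d. \<bar>x' c - x c\<bar> < min r r'"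
    then have "\<bar>g x' - g x\<bar> < \<eta> / 2" "\<bar>g' x' - g' x\<bar> < \<eta> / 2" using r r' by auto
    moreover have "dist (g x', g' x') (g x, g' x) \<le> \<bar>g x' - g x\<bar> + \<bar>g' x' - g' x\<bar>"
      using sqrt_sum_squares_le_sum_abs[of "g x' - g x" "g' x' - g' x"]
      by (simp add: dist_Pair_Pair dist_real_def)
    ultimately have "dist (g x', g' x') (g x, g' x) < \<eta>" by linarith
    from \<eta>(2)[OF this] show "\<bar>bop (g x') (g' x') - bop (g x) (g' x)\<bar> < e"
      by (simp add: dist_real_def)
  qed (use r r' in auto)
qed

lemma poly_fun_coord_cont: "poly_fun d g \<Longrightarrow> coord_cont d g"
proof (induction rule: poly_fun.induct)
  case (poly_const a)
  then show ?case by (auto simp: coord_cont_def intro: exI[of _ 1])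
next
  case (poly_coord j)
  then show ?case by (auto simp: coord_cont_def)
next
  case (poly_add g g')
  then show ?case by (intro coord_cont_combine[where bop = "(+)"] continuous_intros)
next
  case (poly_mult g g')
  then show ?case by (intro coord_cont_combine[where bop = "(*)"] continuous_intros)
qed

lemma poly_fun_smooth:
  assumes "poly_fun d g"
  shows "smooth_fun d g"
proof -
  have pd: "poly_fun d (pd g js)" for js
  proof (induction js)
    case (Cons j js)
    then obtain D where D: "poly_fun d D"
      "\<And>x t. ((\<lambda>t. pd g js (x(j := t))) has_real_derivative D (x(j := t))) (at t)"
      using poly_fun_partial by blast
    have "pd g (j # js) = D"
      using DERIV_imp_deriv[OF D(2)] by fastforce
    then show ?case using D by simp
  qed (simp add: assms)
  have "(\<lambda>t. pd g js (x(j := t))) differentiable (at (x j))" for js x j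
    using poly_fun_partial[OF pd[of js], of j] real_differentiable_def by blast
  then show ?thesis
    unfolding smooth_fun_def using poly_fun_coord_dep[OF assms] poly_fun_coord_cont[OF pd] by blast
qed

lemma poly_fun_prod_list:
  "(\<And>u. u \<in> set us \<Longrightarrow> idx u < d) \<Longrightarrow> poly_fun d (\<lambda>x. prod_list (map (\<lambda>u. x (idx u)) us))"
proof (induction us)
  case Nil
  show ?case by (simp add: poly_const)
next
  case (Cons u us)
  show ?case unfolding list.map prod_list.Cons
    by (intro poly_mult poly_coord Cons) (use Cons.prems in auto)
qed

text \<open>By the product rule, a product of two or more coordinates keeps a vanishing factor at
  the origin. This mirrors the \<open>ga\<close>-term of \<open>theta\<close>, which is present for
  a single child only.\<close>

lemma deriv_monomial_at_0:
  fixes idx :: "'b \<Rightarrow> nat" and d :: nat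
  assumes idx: "\<And>u. u \<in> set us \<Longrightarrow> idx u < d"
  shows "deriv (\<lambda>t. prod_list (map (\<lambda>u. ((\<lambda>_. 0)(l := t)) (idx u)) us)) (0::real)
    = (if length us = 1 \<and> idx (hd us) = l then 1 else 0)"
proof (rule DERIV_imp_deriv, cases us rule: remdups_adj.cases)
  case (2 u)
  then show "((\<lambda>t. prod_list (map (\<lambda>u. ((\<lambda>_. 0)(l := t)) (idx u)) us)) has_real_derivative
      (if length us = 1 \<and> idx (hd us) = l then 1 else 0)) (at 0)"
    by (auto simp: fun_upd_def)
next
  case (3 u v ws)
  have coord: "\<exists>D. ((\<lambda>t. ((\<lambda>_. 0)(l := t)) (idx w)) has_real_derivative D) (at 0)" for w
    by (cases "idx w = l") (auto simp: fun_upd_def intro: DERIV_ident DERIV_const)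
  obtain Du Dv where Du: "((\<lambda>t. ((\<lambda>_. 0)(l := t)) (idx u)) has_real_derivative Du) (at 0)"
    and Dv: "((\<lambda>t. ((\<lambda>_. 0)(l := t)) (idx v)) has_real_derivative Dv) (at 0)"
    using coord by blast
  have "poly_fun d (\<lambda>x. prod_list (map (\<lambda>u. x (idx u)) ws))"
    using idx 3 by (intro poly_fun_prod_list) auto
  then obtain Dw where Dw: "((\<lambda>t. prod_list (map (\<lambda>u. ((\<lambda>_. 0)(l := t)) (idx u)) ws)) has_real_derivative Dw) (at 0)"
    using poly_fun_partial by blast
  have "((\<lambda>t. ((\<lambda>_. 0)(l := t)) (idx u) * (((\<lambda>_. 0)(l := t)) (idx v) *
      prod_list (map (\<lambda>u. ((\<lambda>_. 0)(l := t)) (idx u)) ws))) has_real_derivative 0) (at 0)"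
    using DERIV_mult[OF Du DERIV_mult[OF Dv Dw]] by simp
  then show "((\<lambda>t. prod_list (map (\<lambda>u. ((\<lambda>_. 0)(l := t)) (idx u)) us)) has_real_derivative
      (if length us = 1 \<and> idx (hd us) = l then 1 else 0)) (at 0)"
    using 3 by simp
qed simp

lemma power_sum_list: "prod_list (map (\<lambda>u. (h::real) ^ rho u) us) = h ^ sum_list (map rho us)"
  by (induction us) (auto simp: power_add)

section \<open>The tree system and its local error\<close>

theorem order_conditions_necessary:
  assumes ord: "gark_ros_order N s b al ga p" and t: "colors_ok N t" "rho t \<le> p"
  shows "(\<Sum>m\<in>{1..N}. \<Sum>i\<in>{1..s m}. b m i * theta N s al ga m t i) = 1 / real (dens t)"
proof -
  define U where "U = trees N p"
  define d where "d = card U"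
  obtain idx where idx: "bij_betw idx U {..<d}"
    using ex_bij_betw_finite_nat[OF finite_trees] unfolding U_def d_def by (metis atLeast0LessThan)
  define tr where "tr = inv_into U idx"
  have idx_less: "idx u < d" if "u \<in> U" for u using idx that by (auto dest: bij_betwE)
  have tr_idx: "tr (idx u) = u" if "u \<in> U" for u
    using idx that by (simp add: tr_def bij_betw_inv_into_left)
  have tr_U: "tr c \<in> U" if "c < d" for c
    using bij_betwE[OF bij_betw_inv_into[OF idx]] that by (simp add: tr_def)
  \<comment> \<open>\<open>U\<close> is closed under taking children, so the field defined next
    refers only to coordinates below \<open>d\<close>.\<close>
  have child: "ts \<in> lists U" "r \<in> {1..N}" if "Node r ts \<in> U" for r ts
  proof -
    have "rho u \<le> rho (Node r ts)" if "u \<in> set ts" for u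
      using member_le_sum_list[of "rho u" "map rho ts"] that by fastforce
    then show "ts \<in> lists U" "r \<in> {1..N}" using that unfolding U_def trees_def by fastforce+
  qed
  define f where "f m x c = (if c < d then case tr c of Node r ts \<Rightarrow>
      if r = m then prod_list (map (\<lambda>u. x (idx u)) ts) else 0 else 0)" for m and x :: "nat \<Rightarrow> real" and c
  define y where "y h c = (if c < d then h ^ rho (tr c) / real (dens (tr c)) else 0)" for h :: real and c
  define k where "k h m i c = (if c < d then h ^ rho (tr c) * theta N s al ga m (tr c) i else 0)"
    for h m i c
  have sm: "smooth_field d (f m)" for m
    unfolding smooth_field_def
  proof (intro conjI allI impI)
    fix c assume c: "c < d"
    obtain r ts where rts: "tr c = Node r ts" by (cases "tr c")
    have "poly_fun d (\<lambda>x. f m x c)"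
      using child(1)[of r ts] tr_U[OF c] idx_less c rts
      by (cases "r = m") (auto simp: f_def intro!: poly_fun_prod_list poly_const)
    then show "smooth_fun d (\<lambda>x. f m x c)" by (rule poly_fun_smooth)
  qed (simp add: f_def)
  \<comment> \<open>The interval length 1 is an arbitrary choice: the polynomial solution satisfies
    the system at all times.\<close>
  have sol: "is_solution N d f (\<lambda>_. 0) 1 y"
    unfolding is_solution_def
  proof (intro conjI allI impI ballI)
    have "rho u \<noteq> 0" for u using rho_pos[of u] by simp
    then show "y 0 = (\<lambda>_. 0)" by (auto simp: y_def)
    fix c t assume c: "c < d" and "t \<in> {0..1::real}"
    obtain r ts where rts: "tr c = Node r ts" by (cases "tr c")
    have U: "Node r ts \<in> U" using tr_U[OF c] rts by simp
    have "(\<Sum>m\<in>{1..N}. f m (y t) c) = prod_list (map (\<lambda>u. y t (idx u)) ts)"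
      using child(2)[OF U] c by (simp add: f_def rts)
    also have "map (\<lambda>u. y t (idx u)) ts = map (\<lambda>u. t ^ rho u * (1 / real (dens u))) ts"
      using child(1)[OF U] by (intro map_cong) (auto simp: y_def tr_idx idx_less)
    also have "prod_list \<dots> = t ^ sum_list (map rho ts) * prod_list (map (\<lambda>u. 1 / real (dens u)) ts)"
      unfolding prod_list_map_mult power_sum_list ..
    also have "\<dots> = real (rho (tr c)) * t ^ (rho (tr c) - 1) / real (dens (tr c))"
      unfolding rho_div_dens_Node[of ts r, symmetric] rts by (simp del: dens.simps)
    finally have eq: "(\<Sum>m\<in>{1..N}. f m (y t) c) = real (rho (tr c)) * t ^ (rho (tr c) - 1) / real (dens (tr c))" .
    have "((\<lambda>t. t ^ rho (tr c) / real (dens (tr c))) has_real_derivative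
        real (rho (tr c)) * t ^ (rho (tr c) - 1) / real (dens (tr c))) (at t within {0..1})"
      using DERIV_cdivide[OF DERIV_power[OF DERIV_ident, of "rho (tr c)" t "{0..1}"]] by simp
    then show "((\<lambda>t. y t c) has_real_derivative (\<Sum>m\<in>{1..N}. f m (y t) c)) (at t within {0..1})"
      unfolding eq using c by (simp add: y_def)
  qed
  \<comment> \<open>The stages carry no remainder: a monomial of powers of \<open>h\<close> is one
    power of \<open>h\<close>, and both parts of \<open>theta_Node\<close> appear literally, the
    second through the Jacobian at the origin.\<close>
  have st: "stage_eqs N s al ga d f (\<lambda>_. 0) h (k h)" for h
    unfolding stage_eqs_def
  proof (intro ballI ext)
    fix q i c assume q: "q \<in> {1..N}" and i: "i \<in> {1..s q}"
    define V where "V co c' = (\<Sum>m\<in>{1..N}. \<Sum>j\<in>{1..s m}. co m j * k h m j c')" for co :: "nat \<Rightarrow> nat \<Rightarrow> real" and c'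
    have V: "V co (idx u) = h ^ rho u * (\<Sum>m\<in>{1..N}. \<Sum>j\<in>{1..s m}. co m j * theta N s al ga m u j)"
      if "u \<in> U" for u co
      using that by (simp add: V_def k_def idx_less tr_idx sum_distrib_left algebra_simps)
    have "k h q i c = h * f q (\<lambda>c'. 0 + V (\<lambda>m. al q m i) c') c + h * jac d (f q) (\<lambda>_. 0) (V (\<lambda>m. ga q m i)) c"
    proof (cases "c < d")
      case False
      then show ?thesis by (simp add: k_def f_def jac_def)
    next
      case c: True
      obtain r ts where rts: "tr c = Node r ts" by (cases "tr c")
      have U: "Node r ts \<in> U" using tr_U[OF c] rts by simp
      have ts: "u \<in> U" if "u \<in> set ts" for u using child(1)[OF U] that by auto
      show ?thesis
      proof (cases "r = q")
        case False
        then show ?thesis using c by (simp add: k_def f_def jac_def rts theta_Node_other)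
      next
        case True
        have "f q (V (\<lambda>m. al q m i)) c = prod_list (map (\<lambda>u. V (\<lambda>m. al q m i) (idx u)) ts)"
          using c True by (simp add: f_def rts)
        also have "map (\<lambda>u. V (\<lambda>m. al q m i) (idx u)) ts = map (\<lambda>u. h ^ rho u *
            (\<Sum>m\<in>{1..N}. \<Sum>j\<in>{1..s m}. al q m i j * theta N s al ga m u j)) ts"
          using ts by (intro map_cong) (auto simp: V)
        finally have 1: "f q (V (\<lambda>m. al q m i)) c = h ^ sum_list (map rho ts) *
            prod_list (map (\<lambda>u. \<Sum>m\<in>{1..N}. \<Sum>j\<in>{1..s m}. al q m i j * theta N s al ga m u j) ts)"
          by (simp add: prod_list_map_mult power_sum_list)
        have "jac d (f q) (\<lambda>_. 0) v c = (\<Sum>l<d. (if length ts = 1 \<and> idx (hd ts) = l then 1 else 0) * v l)" for v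
          using c True deriv_monomial_at_0[of ts idx d] ts idx_less
          by (simp add: jac_def f_def rts)
        also have "\<dots> v = (if length ts = 1 then v (idx (hd ts)) else 0)" for v
        proof (cases "length ts = 1")
          case True
          then have "hd ts \<in> set ts" by (cases ts) auto
          then have "idx (hd ts) < d" using ts idx_less by blast
          then show ?thesis using True by (simp add: if_distrib[of "\<lambda>z. z * _"] cong: if_cong)
        qed simp
        finally have "jac d (f q) (\<lambda>_. 0) (V (\<lambda>m. ga q m i)) c
            = (if length ts = 1 then V (\<lambda>m. ga q m i) (idx (hd ts)) else 0)" .
        also have "\<dots> = h ^ sum_list (map rho ts) * (if length ts = 1 then
            \<Sum>m\<in>{1..N}. \<Sum>j\<in>{1..s m}. ga q m i j * theta N s al ga m (hd ts) j else 0)"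
          using ts by (cases ts) (auto simp: V)
        finally have 2: "jac d (f q) (\<lambda>_. 0) (V (\<lambda>m. ga q m i)) c = \<dots>" .
        have "k h q i c = h * (h ^ sum_list (map rho ts) * theta N s al ga q (Node q ts) i)"
          using c True by (simp add: k_def rts)
        then show ?thesis
          unfolding theta_Node using 1 2 by (simp add: distrib_left)
      qed
    qed
    then show "k h q i c =
          h * f q (\<lambda>c'. 0 + (\<Sum>m\<in>{1..N}. \<Sum>j\<in>{1..s m}. al q m i j * k h m j c')) c
        + h * jac d (f q) (\<lambda>_. 0) (\<lambda>c'. \<Sum>m\<in>{1..N}. \<Sum>j\<in>{1..s m}. ga q m i j * k h m j c') c"
      by (simp add: V_def[abs_def])
  qed
  have "\<exists>C del. del > 0 \<and> (\<forall>h k. 0 < h \<and> h < del \<longrightarrow> stage_eqs N s al ga d f (\<lambda>_. 0) h k \<longrightarrow>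
            (\<forall>c<d. \<bar>step_result N s b (\<lambda>_. 0) k c - y h c\<bar> \<le> C * h ^ (p + 1)))"
    using ord sm sol zero_less_one unfolding gark_ros_order_def by blast
  then obtain C r where r: "r > 0" and C: "\<And>h c. 0 < h \<Longrightarrow> h < r \<Longrightarrow> c < d \<Longrightarrow>
      \<bar>step_result N s b (\<lambda>_. 0) (k h) c - y h c\<bar> \<le> C * h ^ (p + 1)"
    using st by blast
  have tU: "t \<in> U" using t by (simp add: U_def trees_def)
  \<comment> \<open>The defect of the order condition for \<open>t\<close>; the local error in the
    coordinate of \<open>t\<close> is exactly \<open>h ^ rho t * X\<close>.\<close>
  define X where "X = (\<Sum>m\<in>{1..N}. \<Sum>i\<in>{1..s m}. b m i * theta N s al ga m t i) - 1 / real (dens t)"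
  have X_le: "\<bar>X\<bar> \<le> C * h ^ (p + 1 - rho t)" if h: "0 < h" "h < r" for h
  proof -
    have "step_result N s b (\<lambda>_. 0) (k h) (idx t) - y h (idx t) = h ^ rho t * X"
      using tU by (simp add: step_result_def k_def y_def idx_less tr_idx X_def right_diff_distrib
          sum_distrib_left algebra_simps)
    then have "h ^ rho t * \<bar>X\<bar> \<le> C * h ^ (p + 1)"
      using C[OF h idx_less[OF tU]] h by (simp add: abs_mult)
    also have "h ^ (p + 1) = h ^ rho t * h ^ (p + 1 - rho t)"
      using t(2) by (simp flip: power_add)
    finally have "h ^ rho t * \<bar>X\<bar> \<le> h ^ rho t * (C * h ^ (p + 1 - rho t))" by (simp add: mult_ac)
    then show ?thesis using h by simp
  qed
  \<comment> \<open>As \<open>rho t \<le> p\<close>, the exponent is at least 1, so letting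
    \<open>h\<close> tend to 0 forces \<open>X = 0\<close>.\<close>
  have "((\<lambda>h::real. C * h ^ (p + 1 - rho t)) \<longlongrightarrow> C * 0 ^ (p + 1 - rho t)) (at_right 0)"
    by (intro tendsto_intros)
  moreover have "\<forall>\<^sub>F h in at_right 0. \<bar>X\<bar> \<le> C * h ^ (p + 1 - rho t)"
    unfolding eventually_at_right_field using X_le r by blast
  ultimately have "\<bar>X\<bar> \<le> C * 0 ^ (p + 1 - rho t)"
    by (rule tendsto_lowerbound) simp
  moreover have "p + 1 - rho t \<noteq> 0" using t(2) by simp
  ultimately have "X = 0" by (simp only: power_0_left if_False)
  then show ?thesis by (simp add: X_def)
qed

theorem mainTheorem3:
  fixes N :: nat and s :: "nat \<Rightarrow> nat" and b :: "nat \<Rightarrow> nat \<Rightarrow> real"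
    and al ga :: "nat \<Rightarrow> nat \<Rightarrow> nat \<Rightarrow> nat \<Rightarrow> real" and p :: nat
  assumes al_lower: "\<And>q m i j. q \<in> {1..N} \<Longrightarrow> m \<in> {1..N} \<Longrightarrow> i \<in> {1..s q} \<Longrightarrow> j \<in> {1..s m}
                        \<Longrightarrow> i \<le> j \<Longrightarrow> al q m i j = 0"
    and ga_lower: "\<And>q m i j. q \<in> {1..N} \<Longrightarrow> m \<in> {1..N} \<Longrightarrow> i \<in> {1..s q} \<Longrightarrow> j \<in> {1..s m}
                        \<Longrightarrow> i < j \<Longrightarrow> ga q m i j = 0"
  shows "gark_ros_order N s b al ga p \<longleftrightarrow>
         (\<forall>t. colors_ok N t \<and> 1 \<le> rho t \<and> rho t \<le> p \<longrightarrow>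
            (\<Sum>m\<in>{1..N}. \<Sum>i\<in>{1..s m}. b m i * theta N s al ga m t i) = 1 / real (dens t))"
proof
  assume "gark_ros_order N s b al ga p"
  then show "\<forall>t. colors_ok N t \<and> 1 \<le> rho t \<and> rho t \<le> p \<longrightarrow>
      (\<Sum>m\<in>{1..N}. \<Sum>i\<in>{1..s m}. b m i * theta N s al ga m t i) = 1 / real (dens t)"
    using order_conditions_necessary by blast
next
  assume "\<forall>t. colors_ok N t \<and> 1 \<le> rho t \<and> rho t \<le> p \<longrightarrow>
      (\<Sum>m\<in>{1..N}. \<Sum>i\<in>{1..s m}. b m i * theta N s al ga m t i) = 1 / real (dens t)"
  then show "gark_ros_order N s b al ga p"
    using al_lower ga_lower rho_pos by (intro order_conditions_sufficient) blast+
qed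

end
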